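(* It is algorithmically decidable, given a finite alphabet $A$ and a finite set of words $w_1,\dots,w_n\in A^\ast$, whether the set $\operatorname{Av}(w_1,\dots,w_n)$ of all words over $A$ which avoid each of $w_1,\dots,w_n$ as a consecutive subword is: (i) atomic; (ii) well quasi-ordered. That is, each of the properties (i) and (ii) is decidable.
   Context: $A^\ast$ is the set of all finite words over $A$. A word $u$ is a consecutive (contiguous) subword, or factor, of a word $v$, written $u\leq_f v$, if $v=yuz$ for some $y,z\in A^\ast$; this is a partial order on $A^\ast$. $\operatorname{Av}(w_1,\dots,w_n)=\{v\in A^\ast : w_i\nleq_f v\text{ for all }i\}$; it is ordered by $\leq_f$. A subset $C$ of a poset $P$ is downward closed if $x\in C$, $y\le x$ imply $y\in C$. A downward closed set is atomic if it is not the union of two proper downward closed subsets (equivalently, it has the joint embedding property: for all $x,y\in C$ there is $z\in C$ with $x\le z$, $y\le z$). A poset is well quasi-ordered if it contains no infinite strictly decreasing sequences and no infinite antichains. *)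

theory Defs
  imports "HOL-Library.Sublist" "HOL-Library.Nat_Bijection"
begin

text \<open>Posets are given by a carrier \<open>P\<close> and a relation \<open>le\<close>. The factor order is \<^const>\<open>sublist\<close>
  (contiguous subwords), and the words over \<open>A\<close> are \<^term>\<open>lists A\<close>.\<close>

definition Av :: "'a set \<Rightarrow> 'a list set \<Rightarrow> 'a list set" where
  "Av A W = {v \<in> lists A. \<forall>w\<in>W. \<not> sublist w v}"

definition downward_closed :: "('a \<Rightarrow> 'a \<Rightarrow> bool) \<Rightarrow> 'a set \<Rightarrow> 'a set \<Rightarrow> bool" where
  "downward_closed le P C \<longleftrightarrow> C \<subseteq> P \<and> (\<forall>x\<in>C. \<forall>y\<in>P. le y x \<longrightarrow> y \<in> C)"

text \<open>The empty set counts as atomic: it has no proper subsets.\<close>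

definition atomic :: "('a \<Rightarrow> 'a \<Rightarrow> bool) \<Rightarrow> 'a set \<Rightarrow> 'a set \<Rightarrow> bool" where
  "atomic le P C \<longleftrightarrow> downward_closed le P C \<and>
     \<not> (\<exists>C1 C2. downward_closed le P C1 \<and> downward_closed le P C2 \<and>
          C1 \<subset> C \<and> C2 \<subset> C \<and> C = C1 \<union> C2)"

definition well_quasi_ordered :: "('a \<Rightarrow> 'a \<Rightarrow> bool) \<Rightarrow> 'a set \<Rightarrow> bool" where
  "well_quasi_ordered le P \<longleftrightarrow>
     \<not> (\<exists>s :: nat \<Rightarrow> 'a. \<forall>i. s i \<in> P \<and> le (s (Suc i)) (s i) \<and> s (Suc i) \<noteq> s i) \<and>
     \<not> (\<exists>X \<subseteq> P. infinite X \<and> (\<forall>x\<in>X. \<forall>y\<in>X. x \<noteq> y \<longrightarrow> \<not> le x y))"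

text \<open>Kleene's general recursive functions: \<open>recursive_fn n f\<close> says that \<open>f\<close>, restricted to argument
  lists of length \<open>n\<close>, is a total recursive function of arity \<open>n\<close>. Values on lists of other lengths
  are irrelevant. Minimization is applied to regular functions only, so everything is total; the
  functions obtained are the total ones among the partial recursive functions.\<close>

inductive recursive_fn :: "nat \<Rightarrow> (nat list \<Rightarrow> nat) \<Rightarrow> bool" where
  zero: "recursive_fn n (\<lambda>xs. 0)"
| succ: "recursive_fn 1 (\<lambda>xs. Suc (xs ! 0))"
| proj: "i < n \<Longrightarrow> recursive_fn n (\<lambda>xs. xs ! i)"
| comp: "recursive_fn (length gs) f \<Longrightarrow> \<forall>g\<in>set gs. recursive_fn n g \<Longrightarrow>
    recursive_fn n (\<lambda>xs. f (map (\<lambda>g. g xs) gs))"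
| prim_rec: "recursive_fn n f \<Longrightarrow> recursive_fn (Suc (Suc n)) g \<Longrightarrow>
    recursive_fn (Suc n) (\<lambda>xs. rec_nat (f (tl xs)) (\<lambda>k r. g (k # r # tl xs)) (hd xs))"
| minimize: "recursive_fn (Suc n) f \<Longrightarrow> \<forall>xs. length xs = n \<longrightarrow> (\<exists>y. f (y # xs) = 0) \<Longrightarrow>
    recursive_fn n (\<lambda>xs. LEAST y. f (y # xs) = 0)"

definition decidable :: "nat set \<Rightarrow> bool" where
  "decidable S \<longleftrightarrow> (\<exists>f. recursive_fn 1 f \<and> (\<forall>n. f [n] = (if n \<in> S then 1 else 0)))"

text \<open>An instance consists of a list of letters (natural numbers), enumerating the finite alphabet,
  and a list of words. Its code is a Goedel number built from the standard bijections between
  lists or pairs of natural numbers and natural numbers. The decision problem for a property \<open>Q\<close> of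
  alphabets and finite sets of words over them is the set of codes of the positive instances.\<close>

definition encode_instance :: "nat list \<Rightarrow> nat list list \<Rightarrow> nat" where
  "encode_instance as ws = prod_encode (list_encode as, list_encode (map list_encode ws))"

definition decision_problem :: "(nat set \<Rightarrow> nat list set \<Rightarrow> bool) \<Rightarrow> nat set" where
  "decision_problem Q =
     {encode_instance as ws | as ws. set ws \<subseteq> lists (set as) \<and> Q (set as) (set ws)}"

end

theory Submission imports Defs
begin

text \<open>Let \<open>m > 0\<close> be at least the length of every forbidden word. A word of length at least \<open>m\<close> avoids
  the forbidden words as soon as all its factors of length \<open>m\<close> do. Hence the long avoiding words are
  the walks of a finite digraph: its vertices are the avoiding words of length \<open>m\<close>, and an edge joins
  two of them that overlap in \<open>m - 1\<close> letters. The passage from words to walks preserves and reflects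
  the factor order (\<open>sublist_windows_iff\<close>, \<open>walk_windows\<close>, \<open>word_of_walk\<close>), so both questions become
  questions about the walks of a finite digraph, and the shorter words are finite in number.

  Atomicity is the joint embedding property (\<open>atomic_iff_joint_embedding\<close>), and it suffices to test it
  on short walks (\<open>joint_embedding_bounded\<close>). If the digraph is strongly connected, any two walks can
  be joined. Otherwise the vertices reachable from a suitable vertex form a proper set \<open>T\<close> that walks
  enter but never leave. Every walk crosses into \<open>T\<close> at most once, so two walks crossing into \<open>T\<close>
  that lie in a common walk are aligned at their crossings. Short walks therefore already force
  exactly one edge into \<open>T\<close>, at most one successor inside \<open>T\<close>, and at most one predecessor outside; then
  every walk is part of a walk through the crossing edge, whose two halves are determined by their
  lengths, and any two such walks fit together. Repeated vertices can be cut out of the part of a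
  common extension that lies between the two walks, so the search for it is bounded as well.

  Proper factors are shorter, so well quasi-order fails exactly if there is an infinite antichain. This
  happens if and only if some closed walk can be entered from a vertex of in-degree at least
  two and left towards a vertex of out-degree at least two. In that case some simple cycle has both an
  edge into it and an edge out of it, and the walks that enter it, go round \<open>k\<close> times, and leave it
  form an antichain (\<open>walk_antichain_infinite\<close>). In the other case every walk is a backward determined
  piece, a piece without repeated vertices, and a forward determined piece, so that up to finitely many
  types it is given by the lengths of the outer pieces, and among infinitely many pairs of natural
  numbers two are comparable (\<open>walk_antichain_finite\<close>).

  Both criteria are list programs. To see that they are recursive, functions between types of codable
  data are called computable if a recursive function tracks them on codes; this notion contains
  primitive recursion and folding over lists and is closed under composition, which yields all the
  list operations that the two programs use.\<close>

section \<open>Total recursive functions up to argument length\<close>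

text \<open>The inductive definition of recursive functions fixes the values also on argument lists of the wrong
  length. Passing to agreement on lists of length \<open>n\<close> makes the notion extensional.\<close>

definition total_recursive :: "nat \<Rightarrow> (nat list \<Rightarrow> nat) \<Rightarrow> bool" where
  "total_recursive n f \<longleftrightarrow> (\<exists>g. recursive_fn n g \<and> (\<forall>xs. length xs = n \<longrightarrow> g xs = f xs))"

lemma total_recursive_cong:
  assumes "total_recursive n f" and "\<And>xs. length xs = n \<Longrightarrow> f xs = g xs"
  shows "total_recursive n g"
  using assms unfolding total_recursive_def by auto

lemma total_recursive_zero: "total_recursive n (\<lambda>xs. 0)"
  unfolding total_recursive_def using recursive_fn.zero by blast

lemma total_recursive_succ: "total_recursive 1 (\<lambda>xs. Suc (xs ! 0))"
  unfolding total_recursive_def using recursive_fn.succ by blast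

lemma total_recursive_nth: "i < n \<Longrightarrow> total_recursive n (\<lambda>xs. xs ! i)"
  unfolding total_recursive_def using recursive_fn.proj by blast

lemma total_recursive_comp:
  assumes f: "total_recursive (length gs) f" and gs: "\<forall>g\<in>set gs. total_recursive n g"
  shows "total_recursive n (\<lambda>xs. f (map (\<lambda>g. g xs) gs))"
proof -
  from f obtain f' where f': "recursive_fn (length gs) f'"
    "\<And>xs. length xs = length gs \<Longrightarrow> f' xs = f xs"
    unfolding total_recursive_def by blast
  from gs obtain h where h: "\<And>g. g \<in> set gs \<Longrightarrow> recursive_fn n (h g)"
    "\<And>g xs. g \<in> set gs \<Longrightarrow> length xs = n \<Longrightarrow> h g xs = g xs"
    unfolding total_recursive_def by metis
  have "recursive_fn n (\<lambda>xs. f' (map (\<lambda>g. g xs) (map h gs)))"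
    by (rule recursive_fn.comp) (use f' h in auto)
  moreover have "f' (map (\<lambda>g. g xs) (map h gs)) = f (map (\<lambda>g. g xs) gs)" if "length xs = n" for xs
  proof -
    have "map (\<lambda>g. g xs) (map h gs) = map (\<lambda>g. g xs) gs" using h(2) that by simp
    then show ?thesis using f'(2)[of "map (\<lambda>g. g xs) gs"] by (simp del: map_map)
  qed
  ultimately show ?thesis unfolding total_recursive_def by blast
qed

lemma total_recursive_prim_rec:
  assumes f: "total_recursive n f" and g: "total_recursive (Suc (Suc n)) g"
  shows "total_recursive (Suc n) (\<lambda>xs. rec_nat (f (tl xs)) (\<lambda>k r. g (k # r # tl xs)) (hd xs))"
proof -
  from f obtain f' where f': "recursive_fn n f'" "\<And>xs. length xs = n \<Longrightarrow> f' xs = f xs"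
    unfolding total_recursive_def by blast
  from g obtain g' where g': "recursive_fn (Suc (Suc n)) g'"
    "\<And>xs. length xs = Suc (Suc n) \<Longrightarrow> g' xs = g xs"
    unfolding total_recursive_def by blast
  have "rec_nat (f' (tl xs)) (\<lambda>k r. g' (k # r # tl xs)) m
      = rec_nat (f (tl xs)) (\<lambda>k r. g (k # r # tl xs)) m" if "length xs = Suc n" for xs m
    using that f'(2) g'(2) by (induction m) auto
  then show ?thesis
    using recursive_fn.prim_rec[OF f'(1) g'(1)] unfolding total_recursive_def by blast
qed

lemma total_recursive_comp1:
  assumes "total_recursive 1 (\<lambda>xs. f (xs ! 0))" and "total_recursive n a"
  shows "total_recursive n (\<lambda>xs. f (a xs))"
  using total_recursive_comp[of "[a]" "\<lambda>xs. f (xs ! 0)" n] assms by simp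

lemma total_recursive_comp2:
  assumes "total_recursive 2 (\<lambda>xs. f (xs ! 0) (xs ! 1))"
    and "total_recursive n a" and "total_recursive n b"
  shows "total_recursive n (\<lambda>xs. f (a xs) (b xs))"
  using total_recursive_comp[of "[a, b]" "\<lambda>xs. f (xs ! 0) (xs ! 1)" n] assms
  by (simp add: numeral_2_eq_2)

lemma total_recursive_Suc: "total_recursive n a \<Longrightarrow> total_recursive n (\<lambda>xs. Suc (a xs))"
  by (rule total_recursive_comp1[OF total_recursive_succ])

lemma total_recursive_const: "total_recursive n (\<lambda>xs. c)"
  by (induction c) (auto intro: total_recursive_zero total_recursive_Suc)

text \<open>Primitive recursion without parameters is recursion at arity zero, where the base case is a
  constant.\<close>

lemma total_recursive_rec0:
  assumes "total_recursive 2 (\<lambda>xs. g (xs ! 0) (xs ! 1))" and "total_recursive n a"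
  shows "total_recursive n (\<lambda>xs. rec_nat c g (a xs))"
proof -
  have "total_recursive (Suc 0)
      (\<lambda>xs. rec_nat c (\<lambda>k r. (\<lambda>xs. g (xs ! 0) (xs ! 1)) (k # r # tl xs)) (hd xs))"
    by (rule total_recursive_prim_rec[of 0 "\<lambda>_. c"])
       (use assms(1) total_recursive_const in \<open>auto simp: numeral_2_eq_2\<close>)
  then have "total_recursive 1 (\<lambda>xs. rec_nat c g (xs ! 0))"
    by (auto elim!: total_recursive_cong simp: length_Suc_conv)
  then show ?thesis using assms(2) by (rule total_recursive_comp1)
qed

lemma total_recursive_rec1:
  assumes "total_recursive 1 (\<lambda>xs. f (xs ! 0))"
    and "total_recursive 3 (\<lambda>xs. g (xs ! 2) (xs ! 0) (xs ! 1))"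
    and "total_recursive n a" and "total_recursive n b"
  shows "total_recursive n (\<lambda>xs. rec_nat (f (b xs)) (g (b xs)) (a xs))"
proof -
  have "total_recursive (Suc 1) (\<lambda>xs. rec_nat ((\<lambda>xs. f (xs ! 0)) (tl xs))
      (\<lambda>k r. (\<lambda>xs. g (xs ! 2) (xs ! 0) (xs ! 1)) (k # r # tl xs)) (hd xs))"
    by (rule total_recursive_prim_rec) (use assms(1,2) in \<open>simp_all add: numeral_3_eq_3\<close>)
  then have "total_recursive 2 (\<lambda>xs. rec_nat (f (xs ! 1)) (g (xs ! 1)) (xs ! 0))"
    unfolding numeral_2_eq_2
    by (auto elim!: total_recursive_cong simp: length_Suc_conv)
  then show ?thesis
    by (rule total_recursive_comp2[where f = "\<lambda>x y. rec_nat (f y) (g y) x"]) (use assms in auto)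
qed

lemma total_recursive_add:
  assumes "total_recursive n a" and "total_recursive n b"
  shows "total_recursive n (\<lambda>xs. a xs + b xs)"
proof -
  have *: "x + y = rec_nat y (\<lambda>k r. Suc r) x" for x y by (induction x) auto
  show ?thesis unfolding *
    by (rule total_recursive_rec1[where f = "\<lambda>y. y" and g = "\<lambda>y k r. Suc r"])
       (use assms in \<open>auto intro!: total_recursive_nth total_recursive_Suc\<close>)
qed

lemma total_recursive_diff:
  assumes "total_recursive n a" and "total_recursive n b"
  shows "total_recursive n (\<lambda>xs. a xs - b xs)"
proof -
  let ?pred = "rec_nat 0 (\<lambda>k r. k)"
  have pred: "?pred x = x - 1" for x :: nat by (cases x) auto
  have *: "x - y = rec_nat x (\<lambda>k r. ?pred r) y" for x y :: nat
    unfolding pred by (induction y) auto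
  have "total_recursive 3 (\<lambda>xs. ?pred (xs ! 1))"
    by (intro total_recursive_rec0 total_recursive_nth) auto
  then show ?thesis unfolding *
    by (rule total_recursive_rec1[where f = "\<lambda>y. y" and g = "\<lambda>y k r. ?pred r", rotated])
       (simp_all add: assms total_recursive_nth[where n = "Suc 0"])
qed

lemma total_recursive_if_zero:
  assumes "total_recursive n a" and "total_recursive n b" and "total_recursive n c"
  shows "total_recursive n (\<lambda>xs. if a xs = 0 then b xs else c xs)"
proof -
  have *: "(if x = 0 then y else z)
      = rec_nat 0 (\<lambda>k r. y) (1 - x) + rec_nat 0 (\<lambda>k r. z) x" for x y z :: nat
    by (cases x) auto
  have rec: "total_recursive n (\<lambda>xs. rec_nat 0 (\<lambda>k r. d xs) (e xs))"
    if "total_recursive n d" "total_recursive n e" for d e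
    by (rule total_recursive_rec1[where f = "\<lambda>y. 0" and g = "\<lambda>y k r. y"])
       (use that in \<open>auto intro!: total_recursive_nth total_recursive_zero\<close>)
  show ?thesis unfolding *
    by (intro total_recursive_add rec total_recursive_diff total_recursive_const assms)
qed

lemma total_recursive_if_eq:
  assumes "total_recursive n a" and "total_recursive n b"
    and "total_recursive n c" and "total_recursive n d"
  shows "total_recursive n (\<lambda>xs. if a xs = b xs then c xs else d xs)"
proof -
  have "total_recursive n (\<lambda>xs. if (a xs - b xs) + (b xs - a xs) = 0 then c xs else d xs)"
    using assms by (intro total_recursive_if_zero total_recursive_add total_recursive_diff)
  then show ?thesis by (rule total_recursive_cong) auto
qed

lemma total_recursive_triangle:
  assumes "total_recursive n a" shows "total_recursive n (\<lambda>xs. triangle (a xs))"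
proof -
  have *: "triangle m = rec_nat 0 (\<lambda>k r. r + Suc k) m" for m by (induction m) auto
  show ?thesis unfolding *
    by (intro total_recursive_rec0 total_recursive_add total_recursive_Suc total_recursive_nth assms)
       auto
qed

lemma total_recursive_prod_encode:
  assumes "total_recursive n a" and "total_recursive n b"
  shows "total_recursive n (\<lambda>xs. prod_encode (a xs, b xs))"
  unfolding prod_encode_def using assms
  by (simp add: total_recursive_add total_recursive_triangle)

text \<open>The diagonal on which a code lies: it moves on by one exactly when the next triangle number is
  reached, which makes it primitive recursive without any search.\<close>

definition diagonal :: "nat \<Rightarrow> nat" where
  "diagonal = rec_nat 0 (\<lambda>k r. if Suc k = triangle (Suc r) then Suc r else r)"

lemma diagonal_bounds: "triangle (diagonal k) \<le> k \<and> k < triangle (Suc (diagonal k))"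
  by (induction k) (auto simp: diagonal_def)

lemma diagonal_prod_encode: "diagonal (prod_encode (a, b)) = a + b"
proof -
  have mono: "triangle i \<le> triangle j" if "i \<le> j" for i j
    using that by (induction rule: dec_induct) auto
  let ?k = "prod_encode (a, b)"
  have k: "triangle (a + b) \<le> ?k" "?k < triangle (Suc (a + b))" by (auto simp: prod_encode_def)
  have "\<not> diagonal ?k < a + b"
    using mono[of "Suc (diagonal ?k)" "a + b"] k diagonal_bounds[of ?k] by linarith
  moreover have "\<not> a + b < diagonal ?k"
    using mono[of "Suc (a + b)" "diagonal ?k"] k diagonal_bounds[of ?k] by linarith
  ultimately show ?thesis by simp
qed

lemma prod_decode_diagonal:
  "fst (prod_decode k) = k - triangle (diagonal k)"
  "snd (prod_decode k) = diagonal k - (k - triangle (diagonal k))"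
proof -
  obtain a b where ab: "prod_decode k = (a, b)" by (cases "prod_decode k")
  then have k: "k = prod_encode (a, b)" by (metis prod_decode_inverse)
  then have "k - triangle (diagonal k) = a"
    using diagonal_prod_encode by (simp add: prod_encode_def)
  then show "fst (prod_decode k) = k - triangle (diagonal k)"
    "snd (prod_decode k) = diagonal k - (k - triangle (diagonal k))"
    using ab k diagonal_prod_encode by auto
qed

lemma total_recursive_diagonal:
  assumes "total_recursive n a" shows "total_recursive n (\<lambda>xs. diagonal (a xs))"
  unfolding diagonal_def
  by (intro total_recursive_rec0 total_recursive_if_eq total_recursive_triangle total_recursive_Suc
      total_recursive_nth assms) auto

lemma total_recursive_prod_decode:
  assumes "total_recursive n a"
  shows "total_recursive n (\<lambda>xs. fst (prod_decode (a xs)))"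
    and "total_recursive n (\<lambda>xs. snd (prod_decode (a xs)))"
  unfolding prod_decode_diagonal
  by (intro total_recursive_diff total_recursive_triangle total_recursive_diagonal assms)+

lemmas recursive_intros = total_recursive_const total_recursive_Suc total_recursive_diff
  total_recursive_if_zero total_recursive_if_eq total_recursive_prod_encode
  total_recursive_prod_decode

section \<open>Computable functions on codable data\<close>

text \<open>The codes of pairs and lists agree with the ones used for instances of the decision problems, so that
  the code of an instance is the code of a pair of lists. Only injectivity is demanded, which makes
  room for truth values; predicates are then simply functions to \<^typ>\<open>bool\<close>.\<close>

class encodable =
  fixes enc :: "'a \<Rightarrow> nat"
  assumes enc_inject: "enc x = enc y \<Longrightarrow> x = y"

lemma enc_eq_iff [simp]: "enc x = enc y \<longleftrightarrow> x = y"
  using enc_inject by blast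

instantiation nat :: encodable
begin
definition "enc_nat = (\<lambda>n :: nat. n)"
instance by standard (simp add: enc_nat_def)
end

instantiation bool :: encodable
begin
definition "enc_bool b = (if b then 1 else 0 :: nat)"
instance by standard (simp add: enc_bool_def split: if_splits)
end

instantiation prod :: (encodable, encodable) encodable
begin
definition "enc_prod p = prod_encode (enc (fst p), enc (snd p))"
instance by standard (simp add: enc_prod_def prod_eq_iff)
end

instantiation list :: (encodable) encodable
begin
definition "enc_list xs = list_encode (map enc xs)"
instance by standard (simp add: enc_list_def list_encode_eq inj_map_eq_map inj_def)
end

definition realizes :: "(nat \<Rightarrow> nat) \<Rightarrow> ('a :: encodable \<Rightarrow> 'b :: encodable) \<Rightarrow> bool" where
  "realizes F f \<longleftrightarrow> total_recursive 1 (\<lambda>xs. F (xs ! 0)) \<and> (\<forall>x. F (enc x) = enc (f x))"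

definition computable :: "('a :: encodable \<Rightarrow> 'b :: encodable) \<Rightarrow> bool" where
  "computable f \<longleftrightarrow> (\<exists>F. realizes F f)"

lemma realizes_recursive:
  "realizes F f \<Longrightarrow> total_recursive n a \<Longrightarrow> total_recursive n (\<lambda>xs. F (a xs))"
  unfolding realizes_def using total_recursive_comp1 by blast

lemma realizes_enc: "realizes F f \<Longrightarrow> F (enc x) = enc (f x)"
  by (simp add: realizes_def)

lemma computableI:
  assumes "\<And>n a. total_recursive n a \<Longrightarrow> total_recursive n (\<lambda>xs. F (a xs))"
    and "\<And>x. F (enc x) = enc (f x)"
  shows "computable f"
  unfolding computable_def realizes_def using assms total_recursive_nth by blast

named_theorems computable_intros

lemma computable_id [computable_intros]: "computable (\<lambda>x. x)"
  by (rule computableI[of "\<lambda>x. x"]) simp_all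

lemma computable_const [computable_intros]: "computable (\<lambda>x. c)"
  by (rule computableI[of "\<lambda>x. enc c"]) (simp_all add: recursive_intros)

lemma computable_comp:
  assumes "computable f" and "computable g" shows "computable (\<lambda>x. f (g x))"
proof -
  obtain F G where F: "realizes F f"
    and G: "realizes G g"
    using assms unfolding computable_def by blast
  show ?thesis by (rule computableI[of "\<lambda>x. F (G x)"]) (simp_all add: F[THEN realizes_enc] G[THEN realizes_enc]
         F[THEN realizes_recursive] G[THEN realizes_recursive])
qed

lemma computable_Pair [computable_intros]:
  assumes "computable f" and "computable g" shows "computable (\<lambda>x. (f x, g x))"
proof -
  obtain F G where F: "realizes F f"
    and G: "realizes G g"
    using assms unfolding computable_def by blast
  show ?thesis
    by (rule computableI[of "\<lambda>x. prod_encode (F x, G x)"])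
       (simp_all add: F[THEN realizes_enc] G[THEN realizes_enc] enc_prod_def
         recursive_intros F[THEN realizes_recursive] G[THEN realizes_recursive])
qed

lemma computable_fst [computable_intros]:
  assumes "computable f" shows "computable (\<lambda>x. fst (f x))"
  by (rule computable_comp[OF computableI[of "\<lambda>k. fst (prod_decode k)"] assms])
     (simp_all add: recursive_intros enc_prod_def)

lemma computable_snd [computable_intros]:
  assumes "computable f" shows "computable (\<lambda>x. snd (f x))"
  by (rule computable_comp[OF computableI[of "\<lambda>k. snd (prod_decode k)"] assms])
     (simp_all add: recursive_intros enc_prod_def)

lemma computable_comp2:
  assumes "computable (\<lambda>p. f (fst p) (snd p))" and "computable a" and "computable b"
  shows "computable (\<lambda>x. f (a x) (b x))"
  using computable_comp[OF assms(1) computable_Pair[OF assms(2,3)]] by simp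

lemma computable_eq [computable_intros]:
  assumes "computable f" and "computable g" shows "computable (\<lambda>x. f x = g x)"
proof -
  obtain F G where F: "realizes F f"
    and G: "realizes G g"
    using assms unfolding computable_def by blast
  show ?thesis
    by (rule computableI[of "\<lambda>x. if F x = G x then 1 else 0"])
       (auto simp: F[THEN realizes_enc] G[THEN realizes_enc] enc_bool_def
         intro!: recursive_intros F[THEN realizes_recursive] G[THEN realizes_recursive])
qed

lemma computable_if [computable_intros]:
  assumes "computable P" and "computable f" and "computable g"
  shows "computable (\<lambda>x. if P x then f x else g x)"
proof -
  obtain F G H where F: "realizes F f"
    and G: "realizes G g"
    and H: "realizes H P"
    using assms unfolding computable_def by blast
  show ?thesis
    by (rule computableI[of "\<lambda>x. if H x = 0 then G x else F x"])
       (auto simp: F[THEN realizes_enc] G[THEN realizes_enc] H[THEN realizes_enc] enc_bool_def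
         intro!: recursive_intros F[THEN realizes_recursive] G[THEN realizes_recursive]
           H[THEN realizes_recursive])
qed

lemma computable_not [computable_intros]:
  assumes "computable P" shows "computable (\<lambda>x. \<not> P x)"
proof -
  have "(\<not> b) = (if b then False else True)" for b by simp
  then show ?thesis using assms by (simp only:) (intro computable_intros)
qed

lemma computable_conj [computable_intros]:
  assumes "computable P" and "computable Q" shows "computable (\<lambda>x. P x \<and> Q x)"
proof -
  have "(b \<and> c) = (if b then c else False)" for b c by simp
  then show ?thesis using assms by (simp only:) (intro computable_intros)
qed

lemma computable_Suc [computable_intros]:
  assumes "computable f" shows "computable (\<lambda>x. Suc (f x))"
  by (rule computable_comp[OF computableI[of "\<lambda>k. Suc k"] assms])
     (simp_all add: recursive_intros enc_nat_def)

text \<open>In this and the following rules with a functional argument, the environment \<open>x\<close> and the bound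
  variables are packed into one tuple. Used backwards, the rules turn a bound variable into a
  projection, so that the computability of a program is proved by resolving with
  \<open>computable_intros\<close> alone.\<close>

lemma computable_rec_nat [computable_intros]:
  assumes "computable f" and "computable (\<lambda>p. g (fst p) (fst (snd p)) (snd (snd p)))"
    and "computable h"
  shows "computable (\<lambda>x. rec_nat (f x) (\<lambda>k r. g x k r) (h x))"
proof -
  obtain F G H where F: "realizes F f"
    and G: "realizes G (\<lambda>p. g (fst p) (fst (snd p)) (snd (snd p)))"
    and H: "realizes H h"
    using assms unfolding computable_def by blast
  have G': "G (prod_encode (enc x, prod_encode (k, enc r))) = enc (g x k r)" for x k r
    using realizes_enc[OF G, of "(x, k, r)"] by (simp add: enc_prod_def enc_nat_def)
  have rec: "rec_nat (F (enc x)) (\<lambda>k r. G (prod_encode (enc x, prod_encode (k, r)))) m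
      = enc (rec_nat (f x) (\<lambda>k r. g x k r) m)" for x m
    by (induction m) (simp_all add: F[THEN realizes_enc] G')
  show ?thesis
  proof (rule computableI)
    fix n a assume a: "total_recursive n a"
    show "total_recursive n (\<lambda>xs. (\<lambda>c. rec_nat (F c)
        (\<lambda>k r. G (prod_encode (c, prod_encode (k, r)))) (H c)) (a xs))"
      by (rule total_recursive_rec1[where f = F
            and g = "\<lambda>c k r. G (prod_encode (c, prod_encode (k, r)))"])
         (auto intro!: recursive_intros total_recursive_nth a F[THEN realizes_recursive]
           G[THEN realizes_recursive] H[THEN realizes_recursive])
  next
    fix x
    show "(\<lambda>c. rec_nat (F c) (\<lambda>k r. G (prod_encode (c, prod_encode (k, r)))) (H c)) (enc x)
        = enc (rec_nat (f x) (\<lambda>k r. g x k r) (h x))"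
      by (simp add: rec H[THEN realizes_enc] enc_nat_def)
  qed
qed

lemma enc_Nil: "enc [] = 0"
  and enc_Cons: "enc (x # xs) = Suc (prod_encode (enc x, enc xs))"
  by (simp_all add: enc_list_def)

lemma length_le_enc: "length xs \<le> enc xs"
proof (induction xs)
  case (Cons x xs)
  then show ?case
    using le_prod_encode_2[of "enc xs" "enc x"] by (simp add: enc_Cons)
qed simp

lemma computable_Cons [computable_intros]:
  assumes "computable f" and "computable g" shows "computable (\<lambda>x. f x # g x)"
proof -
  obtain F G where F: "realizes F f"
    and G: "realizes G g"
    using assms unfolding computable_def by blast
  show ?thesis
    by (rule computableI[of "\<lambda>x. Suc (prod_encode (F x, G x))"])
       (simp_all add: F[THEN realizes_enc] G[THEN realizes_enc] enc_Cons
         recursive_intros F[THEN realizes_recursive] G[THEN realizes_recursive])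
qed

lemma computable_tl [computable_intros]:
  assumes "computable f" shows "computable (\<lambda>x. tl (f x))"
proof (rule computable_comp[OF computableI[of "\<lambda>k. snd (prod_decode (k - 1))"] assms])
  have "prod_decode 0 = (0, 0)"
    by (simp add: prod_decode_def prod_decode_aux.simps)
  then show "snd (prod_decode (enc xs - 1)) = enc (tl xs)" for xs :: "'b list"
    by (cases xs) (simp_all add: enc_Nil enc_Cons)
qed (auto intro!: recursive_intros)

text \<open>The recursion along a list is simulated by iterating a step on pairs of the remaining list and the
  accumulator. The code of the list serves as the number of iterations: it is at least the length of
  the list, and further steps change nothing once the list is exhausted.\<close>

lemma computable_fold [computable_intros]:
  assumes "computable (\<lambda>p. g (fst p) (fst (snd p)) (snd (snd p)))"
    and "computable l" and "computable a"
  shows "computable (\<lambda>x. fold (\<lambda>y r. g x y r) (l x) (a x))"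
proof -
  obtain G L A where G: "realizes G (\<lambda>p. g (fst p) (fst (snd p)) (snd (snd p)))"
    and L: "realizes L l"
    and A: "realizes A a"
    using assms unfolding computable_def by blast
  have G': "G (prod_encode (enc x, prod_encode (enc y, enc r))) = enc (g x y r)" for x y r
    using realizes_enc[OF G, of "(x, y, r)"] by (simp add: enc_prod_def)
  let ?hd = "\<lambda>s. fst (prod_decode (fst (prod_decode s) - 1))"
  let ?tl = "\<lambda>s. snd (prod_decode (fst (prod_decode s) - 1))"
  define step where "step c s = (if fst (prod_decode s) = 0 then s else
    prod_encode (?tl s, G (prod_encode (c, prod_encode (?hd s, snd (prod_decode s))))))" for c s
  have step_Nil: "step c (prod_encode (0, r)) = prod_encode (0, r)" for c r
    by (simp add: step_def)
  have step_Cons: "step (enc x) (prod_encode (enc (y # ys), enc r))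
      = prod_encode (enc ys, enc (g x y r))" for x y ys r
    by (simp add: step_def enc_Cons G')
  have iter: "rec_nat s (\<lambda>_. step c) m = (step c ^^ m) s" for s c m
    by (induction m) auto
  have run: "(step (enc x) ^^ m) (prod_encode (enc ys, enc r))
      = prod_encode (0, enc (fold (\<lambda>y r. g x y r) ys r))"
    if "length ys \<le> m" for x ys r m
    using that
  proof (induction m arbitrary: ys r)
    case (Suc m)
    show ?case
    proof (cases ys)
      case Nil
      then show ?thesis
        using Suc.IH[of "[]" r] by (simp add: enc_Nil step_Nil)
    next
      case (Cons y ys')
      then show ?thesis
        using Suc.IH[of ys' "g x y r"] Suc.prems
        by (simp add: funpow_Suc_right step_Cons del: funpow.simps)
    qed
  qed (simp add: enc_Nil)
  show ?thesis
  proof (rule computableI)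
    fix n b assume b: "total_recursive n b"
    have step: "total_recursive 3 (\<lambda>xs. step (xs ! 2) (xs ! 1))"
      unfolding step_def
      by (auto intro!: recursive_intros total_recursive_nth G[THEN realizes_recursive])
    have "total_recursive n (\<lambda>xs. rec_nat (prod_encode (L (b xs), A (b xs)))
        (\<lambda>_. step (b xs)) (L (b xs)))"
      by (rule total_recursive_rec1[where f = "\<lambda>c. prod_encode (L c, A c)"
            and g = "\<lambda>c _. step c"])
         (auto intro!: recursive_intros total_recursive_nth b step[simplified] L[THEN realizes_recursive]
           A[THEN realizes_recursive])
    then show "total_recursive n (\<lambda>xs. (\<lambda>c. snd (prod_decode
        (rec_nat (prod_encode (L c, A c)) (\<lambda>_. step c) (L c)))) (b xs))"
      by (rule total_recursive_prod_decode)
  next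
    fix x
    show "(\<lambda>c. snd (prod_decode (rec_nat (prod_encode (L c, A c)) (\<lambda>_. step c) (L c)))) (enc x)
        = enc (fold (\<lambda>y r. g x y r) (l x) (a x))"
      by (simp add: iter L[THEN realizes_enc] A[THEN realizes_enc] run[OF length_le_enc])
  qed
qed

lemma computable_rev [computable_intros]:
  assumes "computable f" shows "computable (\<lambda>x. rev (f x))"
proof -
  have "rev xs = fold (\<lambda>y r. y # r) xs []" for xs :: "'b list"
    by (simp add: rev_conv_fold)
  then show ?thesis using assms by (simp only:) (intro computable_intros)
qed

lemma computable_append [computable_intros]:
  assumes "computable f" and "computable g" shows "computable (\<lambda>x. f x @ g x)"
proof -
  have "xs @ ys = fold (\<lambda>y r. y # r) (rev xs) ys" for xs ys :: "'b list"
    by (simp add: fold_Cons_rev)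
  then show ?thesis using assms by (simp only:) (intro computable_intros)
qed

lemma computable_length [computable_intros]:
  assumes "computable f" shows "computable (\<lambda>x. length (f x))"
proof -
  have *: "fold (\<lambda>y r. Suc r) xs n = n + length xs" for xs :: "'b list" and n
    by (induction xs arbitrary: n) auto
  have "length xs = fold (\<lambda>y r. Suc r) xs 0" for xs :: "'b list" by (simp add: *)
  then show ?thesis using assms by (simp only:) (intro computable_intros)
qed

lemma computable_map [computable_intros]:
  assumes "computable (\<lambda>p. g (fst p) (snd p))" and "computable l"
  shows "computable (\<lambda>x. map (\<lambda>y. g x y) (l x))"
proof -
  have *: "fold (\<lambda>y r. h y # r) xs r = rev (map h xs) @ r" for h :: "'b \<Rightarrow> 'c" and xs r
    by (induction xs arbitrary: r) auto
  have "map h xs = rev (fold (\<lambda>y r. h y # r) xs [])" for h :: "'b \<Rightarrow> 'c" and xs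
    by (simp add: *)
  then show ?thesis
    by (simp only:) (intro computable_intros computable_comp2[OF assms(1)] assms(2))
qed

lemma computable_filter [computable_intros]:
  assumes "computable (\<lambda>p. P (fst p) (snd p))" and "computable l"
  shows "computable (\<lambda>x. filter (\<lambda>y. P x y) (l x))"
proof -
  have *: "fold (\<lambda>y r. if h y then y # r else r) xs r = rev (filter h xs) @ r"
    for h :: "'b \<Rightarrow> bool" and xs r
    by (induction xs arbitrary: r) auto
  have "filter h xs = rev (fold (\<lambda>y r. if h y then y # r else r) xs [])"
    for h :: "'b \<Rightarrow> bool" and xs
    by (simp add: *)
  then show ?thesis
    by (simp only:) (intro computable_intros computable_comp2[OF assms(1)] assms(2))
qed

lemma computable_ball [computable_intros]:
  assumes "computable (\<lambda>p. P (fst p) (snd p))" and "computable l"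
  shows "computable (\<lambda>x. \<forall>y\<in>set (l x). P x y)"
proof -
  have *: "fold (\<lambda>y r. r \<and> h y) xs r \<longleftrightarrow> r \<and> (\<forall>y\<in>set xs. h y)" for h :: "'b \<Rightarrow> bool" and xs r
    by (induction xs arbitrary: r) auto
  have "(\<forall>y\<in>set xs. h y) \<longleftrightarrow> fold (\<lambda>y r. r \<and> h y) xs True" for h :: "'b \<Rightarrow> bool" and xs
    by (simp add: *)
  then show ?thesis
    by (simp only:) (intro computable_intros computable_comp2[OF assms(1)] assms(2))
qed

lemma computable_bex [computable_intros]:
  assumes "computable (\<lambda>p. P (fst p) (snd p))" and "computable l"
  shows "computable (\<lambda>x. \<exists>y\<in>set (l x). P x y)"
  using computable_not[OF computable_ball[of "\<lambda>x y. \<not> P x y", OF computable_not[OF assms(1)] assms(2)]]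
  by simp

lemma computable_concat [computable_intros]:
  assumes "computable f" shows "computable (\<lambda>x. concat (f x))"
proof -
  have *: "fold (\<lambda>y r. r @ y) xs r = r @ concat xs" for xs :: "'b list list" and r
    by (induction xs arbitrary: r) auto
  have "concat xs = fold (\<lambda>y r. r @ y) xs []" for xs :: "'b list list" by (simp add: *)
  then show ?thesis using assms by (simp only:) (intro computable_intros)
qed

lemma computable_drop [computable_intros]:
  assumes "computable f" and "computable g" shows "computable (\<lambda>x. drop (f x) (g x))"
proof -
  have "drop n xs = rec_nat xs (\<lambda>k r. tl r) n" for n and xs :: "'b list"
    by (induction n) (simp_all add: drop_Suc flip: tl_drop)
  then show ?thesis using assms by (simp only:) (intro computable_intros)
qed

lemma computable_add [computable_intros]:
  assumes "computable f" and "computable g" shows "computable (\<lambda>x. f x + g x :: nat)"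
proof -
  have "m + n = rec_nat n (\<lambda>k r. Suc r) m" for m n by (induction m) auto
  then show ?thesis using assms by (simp only:) (intro computable_intros)
qed

lemma computable_diff [computable_intros]:
  assumes "computable f" and "computable g" shows "computable (\<lambda>x. f x - g x :: nat)"
proof -
  have "n - m = length (drop m (rec_nat [] (\<lambda>k r. k # r) n))" for m n :: nat
  proof -
    have "length (rec_nat [] (\<lambda>k r. k # r) n) = n" for n :: nat by (induction n) auto
    then show ?thesis by simp
  qed
  then show ?thesis using assms by (simp only:) (intro computable_intros)
qed

lemma computable_take [computable_intros]:
  assumes "computable f" and "computable g" shows "computable (\<lambda>x. take (f x) (g x))"
proof -
  have "take n xs = rev (drop (length xs - n) (rev xs))" for n and xs :: "'b list"
    by (cases "n \<le> length xs") (simp_all add: rev_drop)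
  then show ?thesis using assms by (simp only:) (intro computable_intros)
qed

lemma computable_butlast [computable_intros]:
  assumes "computable f" shows "computable (\<lambda>x. butlast (f x))"
proof -
  have "butlast xs = rev (tl (rev xs))" for xs :: "'b list"
    by (induction xs rule: rev_induct) auto
  then show ?thesis using assms by (simp only:) (intro computable_intros)
qed

lemma computable_upt0 [computable_intros]:
  assumes "computable f" shows "computable (\<lambda>x. [0..<f x])"
proof -
  have "[0..<n] = rec_nat [] (\<lambda>k r. r @ [k]) n" for n by (induction n) auto
  then show ?thesis using assms by (simp only:) (intro computable_intros)
qed

lemma computable_n_lists [computable_intros]:
  assumes "computable f" and "computable g" shows "computable (\<lambda>x. List.n_lists (f x) (g x))"
proof -
  have "List.n_lists n xs
      = rec_nat [[]] (\<lambda>k r. concat (map (\<lambda>ys. map (\<lambda>y. y # ys) xs) r)) n"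
    for n and xs :: "'b list"
    by (induction n) auto
  then show ?thesis by (simp only:) (intro computable_intros assms computable_comp[OF assms(2)])
qed

lemma sublist_iff_take_drop:
  "sublist x y \<longleftrightarrow> (\<exists>i\<in>set [0..<Suc (length y)]. take (length x) (drop i y) = x)"
proof
  assume "sublist x y"
  then obtain p s where y: "y = p @ x @ s" by (auto simp: sublist_def)
  then show "\<exists>i\<in>set [0..<Suc (length y)]. take (length x) (drop i y) = x"
    by (intro bexI[of _ "length p"]) auto
next
  assume "\<exists>i\<in>set [0..<Suc (length y)]. take (length x) (drop i y) = x"
  then obtain i where "take (length x) (drop i y) = x" by auto
  then show "sublist x y" by (metis sublist_take sublist_drop sublist_order.order_trans)
qed

lemma computable_sublist [computable_intros]:
  assumes "computable f" and "computable g" shows "computable (\<lambda>x. sublist (f x) (g x))"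
  unfolding sublist_iff_take_drop
  by (intro computable_intros computable_comp[OF assms(1)] computable_comp[OF assms(2)] assms)

text \<open>Every number codes exactly one pair of a list of letters and a list of words, so a computable test
  on pairs decides the set of codes. The test is preceded by a check that the words are words over the
  given letters.\<close>

lemma decidable_decision_problem:
  assumes comp: "computable P"
    and P: "\<And>as ws. set ws \<subseteq> lists (set as) \<Longrightarrow> P (as, ws) \<longleftrightarrow> Q (set as) (set ws)"
  shows "decidable (decision_problem Q)"
proof -
  define R where "R i \<longleftrightarrow> (\<forall>w\<in>set (snd i). \<forall>a\<in>set w. \<exists>b\<in>set (fst i). a = b) \<and> P i"
    for i :: "nat list \<times> nat list list"
  have "computable R"
    unfolding R_def by (intro computable_intros comp)
  then obtain g where g: "total_recursive 1 (\<lambda>xs. g (xs ! 0))" "\<And>i. g (enc i) = enc (R i)"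
    unfolding computable_def realizes_def by blast
  then obtain f where f: "recursive_fn 1 f" "\<And>n. f [n] = g n"
    unfolding total_recursive_def by force
  have enc: "encode_instance as ws = enc (as, ws)" for as ws
  proof -
    have "enc = (list_encode :: nat list \<Rightarrow> nat)" by (auto simp: enc_list_def enc_nat_def)
    then show ?thesis by (simp add: encode_instance_def enc_prod_def enc_list_def[of ws])
  qed
  have R: "R (as, ws) \<longleftrightarrow> set ws \<subseteq> lists (set as) \<and> Q (set as) (set ws)" for as ws
    using P by (auto simp: R_def)
  have "f [n] = (if n \<in> decision_problem Q then 1 else 0)" for n
  proof -
    obtain as ws where n: "n = encode_instance as ws"
    proof
      show "n = encode_instance (list_decode (fst (prod_decode n)))
          (map list_decode (list_decode (snd (prod_decode n))))"
        by (simp add: encode_instance_def comp_def)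
    qed
    have "n \<in> decision_problem Q \<longleftrightarrow> R (as, ws)"
      by (auto simp: decision_problem_def n R enc)
    then show ?thesis by (simp add: f n enc g enc_bool_def)
  qed
  then show ?thesis using f unfolding decidable_def by blast
qed

section \<open>Walks in finite digraphs\<close>

text \<open>Two factors of a word either overlap or touch, and then their union is a short factor, or there is a
  gap between them.\<close>

lemma sublist_two_cases:
  assumes "sublist x z" and "sublist y z"
  shows "(\<exists>z'. sublist z' z \<and> sublist x z' \<and> sublist y z' \<and> length z' \<le> length x + length y)
    \<or> (\<exists>g. sublist (x @ g @ y) z) \<or> (\<exists>g. sublist (y @ g @ x) z)"
proof -
  have wlog: "(\<exists>z'. sublist z' z \<and> sublist x z' \<and> sublist y z' \<and> length z' \<le> length x + length y)
      \<or> (\<exists>g. sublist (x @ g @ y) z)"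
    if z: "z = p @ x @ s" "z = q @ y @ t" and pq: "length p \<le> length q" for x y p q s t
  proof -
    have split: "\<exists>d. b = a @ d \<and> u = d @ v" if "a @ u = b @ v" "length a \<le> length b" for a b u v :: "'a list"
      using that by (metis append_eq_append_conv_if append_take_drop_id)
    obtain d where d: "q = p @ d" "x @ s = d @ y @ t"
      using split[of p "x @ s" q "y @ t"] z pq by auto
    consider g where "d = x @ g" | e where "x = d @ e" "e @ s = y @ t"
      using split[OF d(2)] split[OF d(2)[symmetric]] by (metis nle_le)
    then show ?thesis
    proof cases
      case 1
      then have "z = p @ (x @ g @ y) @ t" using z(2) d(1) by simp
      then show ?thesis by blast
    next
      case 2
      then consider f where "y = e @ f" | f where "e = y @ f"
        using split[OF 2(2)] split[OF 2(2)[symmetric]] by (metis nle_le)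
      then show ?thesis
      proof cases
        case 1
        have "z = p @ (d @ y) @ t" "d @ y = x @ f" using z(2) d(1) 2 1 by simp_all
        then have "sublist (d @ y) z" "sublist x (d @ y)" "sublist y (d @ y)"
          by (metis sublist_appendI sublist_append_leftI sublist_append_rightI)+
        then show ?thesis using 2 by (intro disjI1 exI[of _ "d @ y"]) auto
      next
        case f: 2
        have "sublist x z" using z(1) by simp
        moreover have "sublist y x" using 2 f by auto
        ultimately show ?thesis by (intro disjI1 exI[of _ x]) auto
      qed
    qed
  qed
  from assms obtain p s q t where z: "z = p @ x @ s" "z = q @ y @ t"
    unfolding sublist_def by blast
  show ?thesis
  proof (cases "length p \<le> length q")
    case True
    then show ?thesis using wlog[OF z] by blast
  next
    case False
    then show ?thesis using wlog[OF z(2,1)] by (simp add: add.commute) blast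
  qed
qed

locale finite_digraph =
  fixes V :: "'a set" and E :: "'a \<Rightarrow> 'a \<Rightarrow> bool"
  assumes finite_V: "finite V" and E_in_V: "E u v \<Longrightarrow> u \<in> V \<and> v \<in> V"
begin

definition walk :: "'a list \<Rightarrow> bool" where
  "walk p \<longleftrightarrow> set p \<subseteq> V \<and> successively E p"

lemma walk_append: "walk (p @ q) \<longleftrightarrow>
    walk p \<and> walk q \<and> (p = [] \<or> q = [] \<or> E (last p) (hd q))"
  by (auto simp: walk_def successively_append_iff)

lemma walk_Cons: "walk (u # p) \<longleftrightarrow> u \<in> V \<and> walk p \<and> (p = [] \<or> E u (hd p))"
  by (auto simp: walk_def successively_Cons)

lemma walk_Nil [simp]: "walk []"
  by (simp add: walk_def)

lemma walk_sublist: "walk p \<Longrightarrow> sublist q p \<Longrightarrow> walk q"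
  by (auto simp: sublist_def walk_append)

lemma walk_cut:
  assumes "walk (p @ v # q @ v # r)" shows "walk (p @ v # r)"
  using assms by (auto simp: walk_append walk_Cons)

text \<open>A segment with more entries than there are vertices repeats a vertex, and the part between the two
  occurrences can be cut out.\<close>

lemma walk_shorten:
  "walk (x @ g @ y) \<Longrightarrow> \<exists>g'. walk (x @ g' @ y) \<and> length g' \<le> card V"
proof (induction "length g" arbitrary: g rule: less_induct)
  case less
  show ?case
  proof (cases "length g \<le> card V")
    case False
    have "set g \<subseteq> V" using less.prems by (simp add: walk_def)
    then have "card (set g) < length g"
      using False card_mono[OF finite_V] by (meson le_less_trans not_le)
    then have "\<not> distinct g" using distinct_card by fastforce
    then obtain a b c v where g: "g = a @ [v] @ b @ [v] @ c" using not_distinct_decomp by blast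
    then have "walk ((x @ a) @ v # b @ v # (c @ y))" using less.prems by simp
    then have "walk (x @ (a @ v # c) @ y)" using walk_cut[of "x @ a" v b "c @ y"] by simp
    then show ?thesis using less.hyps[of "a @ v # c"] g by simp
  qed (use less.prems in blast)
qed

text \<open>Only the gap between the two walks has to be shortened.\<close>

lemma joint_walk_shorten:
  assumes "walk z" and "sublist x z" and "sublist y z"
  shows "\<exists>z'. walk z' \<and> sublist x z' \<and> sublist y z' \<and> length z' \<le> length x + length y + card V"
proof -
  have *: "\<exists>z'. walk z' \<and> sublist x z' \<and> sublist y z' \<and> length z' \<le> length x + length y + card V"
    if g: "sublist (x @ g @ y) z" for x y g
  proof -
    obtain g' where "walk (x @ g' @ y)" "length g' \<le> card V"
      using walk_shorten[OF walk_sublist[OF assms(1) g]] by blast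
    then show ?thesis by (intro exI[of _ "x @ g' @ y"]) (auto simp flip: append_assoc)
  qed
  from sublist_two_cases[OF assms(2,3)] show ?thesis
  proof (elim disjE exE)
    fix z' assume "sublist z' z \<and> sublist x z' \<and> sublist y z' \<and> length z' \<le> length x + length y"
    then show ?thesis using walk_sublist[OF assms(1)] by (intro exI[of _ z']) auto
  next
    fix g assume "sublist (x @ g @ y) z"
    then show ?thesis by (rule *)
  next
    fix g assume "sublist (y @ g @ x) z"
    then show ?thesis using *[of y g x] by (auto simp: add.commute)
  qed
qed

lemma walk_reach: "walk p \<Longrightarrow> p \<noteq> [] \<Longrightarrow> E\<^sup>*\<^sup>* (hd p) (last p)"
proof (induction p)
  case (Cons u p)
  then show ?case by (cases "p = []") (auto simp: walk_Cons intro: converse_rtranclp_into_rtranclp)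
qed simp

lemma walk_reach_between:
  assumes "walk (p @ u # q @ v # r)" shows "E\<^sup>+\<^sup>+ u v"
proof -
  have "walk (u # q @ [v])" using assms by (auto simp: walk_append walk_Cons hd_append split: if_splits)
  then have "E u (hd (q @ [v]))" "E\<^sup>*\<^sup>* (hd (q @ [v])) v"
    using walk_reach[of "q @ [v]"] by (auto simp: walk_Cons)
  then show ?thesis by (rule rtranclp_into_tranclp2)
qed

lemma tranclp_iff_walk: "E\<^sup>+\<^sup>+ u v \<longleftrightarrow> (\<exists>g. walk (u # g @ [v]) \<and> length g \<le> card V)"
proof
  assume "E\<^sup>+\<^sup>+ u v"
  then have "\<exists>g. walk (u # g @ [v])"
  proof (induction rule: tranclp_induct)
    case (base y)
    then show ?case using E_in_V[of u y] by (intro exI[of _ "[]"]) (auto simp: walk_Cons)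
  next
    case (step y z)
    then obtain g where "walk (u # g @ [y])" by blast
    then have "walk (u # (g @ [y]) @ [z])"
      using step(2) E_in_V[of y z] by (auto simp: walk_Cons walk_append hd_append)
    then show ?case by blast
  qed
  then obtain g where "walk ([u] @ g @ [v])" by auto
  from walk_shorten[OF this] show "\<exists>g. walk (u # g @ [v]) \<and> length g \<le> card V" by simp
next
  assume "\<exists>g. walk (u # g @ [v]) \<and> length g \<le> card V"
  then show "E\<^sup>+\<^sup>+ u v" using walk_reach_between[of "[]" u _ v "[]"] by auto
qed

lemma reach_walk:
  assumes "E\<^sup>*\<^sup>* u v" and "u \<in> V"
  obtains p where "walk p" and "p \<noteq> []" and "hd p = u" and "last p = v"
    and "length p \<le> card V + 2"
proof (cases "u = v")
  case True
  then show ?thesis using assms(2) that[of "[u]"] by (simp add: walk_Cons)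
next
  case False
  then have "E\<^sup>+\<^sup>+ u v" using assms(1) by (auto dest: rtranclpD)
  then obtain g where "walk (u # g @ [v])" "length g \<le> card V" by (auto simp: tranclp_iff_walk)
  then show ?thesis using that[of "u # g @ [v]"] by simp
qed

lemma walk_connect:
  assumes p: "walk p" "p \<noteq> []" and q: "walk q" "q \<noteq> []" and r: "E\<^sup>*\<^sup>* (last p) (hd q)"
  obtains z where "walk z" and "prefix p z" and "suffix q z"
proof (cases "last p = hd q")
  case True
  obtain p' u where p': "p = p' @ [u]" using p(2) by (cases p rule: rev_cases) auto
  obtain q' where q': "q = u # q'" using q(2) True p' by (cases q) auto
  have "walk (p' @ q)" using p(1) q(1) by (auto simp: p' q' walk_append walk_Cons)
  then show ?thesis
    by (intro that[of "p' @ q"]) (auto simp: p' q' prefix_def suffix_def)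
next
  case False
  then have "E\<^sup>+\<^sup>+ (last p) (hd q)" using r by (auto dest: rtranclpD)
  then obtain g where "walk (last p # g @ [hd q])" by (auto simp: tranclp_iff_walk)
  then have "walk (p @ g @ q)" using p q
    by (auto simp: walk_Cons walk_append hd_append split: if_splits)
  then show ?thesis by (intro that[of "p @ g @ q"]) (auto simp: suffix_def)
qed

text \<open>Where successors are unique, a walk is determined by its start and its length.\<close>

lemma forward_deterministic:
  assumes T: "\<And>u v w. u \<in> T \<Longrightarrow> E u v \<Longrightarrow> E u w \<Longrightarrow> v = w \<and> v \<in> T"
  shows "walk (u # p) \<Longrightarrow> walk (u # q) \<Longrightarrow> u \<in> T \<Longrightarrow> prefix p q \<or> prefix q p"
proof (induction p arbitrary: u q)
  case (Cons v p)
  show ?case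
  proof (cases q)
    case q: (Cons w q')
    then have "v = w \<and> v \<in> T" using Cons.prems T by (auto simp: walk_Cons)
    then show ?thesis using Cons.IH[of v q'] Cons.prems q by (auto simp: walk_Cons)
  qed simp
qed simp

lemma finite_digraph_reverse: "finite_digraph V (\<lambda>u v. E v u)"
  using finite_V E_in_V by unfold_locales auto

lemma walk_reverse: "finite_digraph.walk V (\<lambda>u v. E v u) p \<longleftrightarrow> walk (rev p)"
  by (simp add: finite_digraph.walk_def[OF finite_digraph_reverse] walk_def)

lemma backward_deterministic:
  assumes S: "\<And>u v w. u \<in> S \<Longrightarrow> E v u \<Longrightarrow> E w u \<Longrightarrow> v = w \<and> v \<in> S"
    and "walk (p @ [u])" and "walk (q @ [u])" and "u \<in> S"
  shows "suffix p q \<or> suffix q p"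
  using finite_digraph.forward_deterministic[OF finite_digraph_reverse S, where p = "rev p" and q = "rev q"]
    assms(2-4)
  by (simp add: walk_reverse suffix_to_prefix)

end

section \<open>Joint embedding of walks\<close>

text \<open>A list that passes once from the complement of \<open>T\<close> into \<open>T\<close> determines the place of this passage.\<close>

lemma split_at_cut:
  assumes "set p \<inter> T = {}" and "set q \<subseteq> T"
  shows "takeWhile (\<lambda>v. v \<notin> T) (p @ q) = p" and "dropWhile (\<lambda>v. v \<notin> T) (p @ q) = q"
proof -
  have "takeWhile (\<lambda>v. v \<notin> T) q = []" "dropWhile (\<lambda>v. v \<notin> T) q = q"
    using assms(2) by (cases q; auto)+
  then show "takeWhile (\<lambda>v. v \<notin> T) (p @ q) = p" "dropWhile (\<lambda>v. v \<notin> T) (p @ q) = q"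
    using assms(1) by (subst takeWhile_append2 dropWhile_append2; auto)+
qed

context finite_digraph
begin

lemma walk_cut_sets:
  assumes T: "\<forall>u v. u \<in> T \<longrightarrow> E u v \<longrightarrow> v \<in> T"
    and "walk (p @ s # t # q)" and "s \<notin> T" and "t \<in> T"
  shows "set (p @ [s]) \<inter> T = {}" and "set (t # q) \<subseteq> T"
proof -
  have closed: "v \<in> T" if "E\<^sup>*\<^sup>* u v" "u \<in> T" for u v
    using that by (induction rule: rtranclp_induct) (use T in auto)
  have "s \<in> T" if "u \<in> set p" "u \<in> T" for u
  proof -
    from that(1) obtain a b where "p = a @ u # b" by (auto simp: in_set_conv_decomp)
    then have "E\<^sup>+\<^sup>+ u s" using walk_reach_between[of a u b s "t # q"] assms(2) by simp
    then show ?thesis using closed that(2) by (meson tranclp_into_rtranclp)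
  qed
  then show "set (p @ [s]) \<inter> T = {}" using \<open>s \<notin> T\<close> by auto
  have "u \<in> T" if "u \<in> set q" for u
  proof -
    from that(1) obtain a b where "q = a @ u # b" by (auto simp: in_set_conv_decomp)
    then have "E\<^sup>+\<^sup>+ t u" using walk_reach_between[of "p @ [s]" t a u b] assms(2) by simp
    then show ?thesis using closed \<open>t \<in> T\<close> by (meson tranclp_into_rtranclp)
  qed
  then show "set (t # q) \<subseteq> T" using \<open>t \<in> T\<close> by auto
qed

text \<open>A walk crosses into a successor-closed set \<open>T\<close> at one place only. Both given walks cross there, which
  aligns them: the parts in front of the crossing are suffixes, and the parts behind it prefixes, of
  the same lists.\<close>

lemma cut_alignment:
  assumes T: "\<forall>u v. u \<in> T \<longrightarrow> E u v \<longrightarrow> v \<in> T" and z: "walk z"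
    and 1: "sublist (p @ s # t # q) z" "s \<notin> T" "t \<in> T"
    and 2: "sublist (p' @ s' # t' # q') z" "s' \<notin> T" "t' \<in> T"
  shows "s = s' \<and> t = t' \<and> (suffix p p' \<or> suffix p' p) \<and> (prefix q q' \<or> prefix q' q)"
proof -
  have *: "suffix (p @ [s]) (takeWhile (\<lambda>v. v \<notin> T) z) \<and> prefix (t # q) (dropWhile (\<lambda>v. v \<notin> T) z)"
    if "sublist (p @ s # t # q) z" "s \<notin> T" "t \<in> T" for p s t q
  proof -
    from that obtain a b where z': "z = (a @ p @ [s]) @ (t # q @ b)" by (auto simp: sublist_def)
    then show ?thesis
      using walk_cut_sets[OF T, of "a @ p" s t "q @ b"] z that
        split_at_cut[of "a @ p @ [s]" T "t # q @ b"]
      by (auto simp: suffix_def prefix_def)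
  qed
  have "suffix (p @ [s]) (p' @ [s']) \<or> suffix (p' @ [s']) (p @ [s])"
    "prefix (t # q) (t' # q') \<or> prefix (t' # q') (t # q)"
    using *[OF 1] *[OF 2] suffix_same_cases prefix_same_cases by blast+
  then show ?thesis by auto
qed

lemma walk_crossing:
  assumes "walk p" and "p \<noteq> []" and "hd p \<notin> T" and "last p \<in> T"
  obtains a s t b where "p = a @ s # t # b" and "s \<notin> T" and "t \<in> T" and "E s t"
proof -
  have "\<exists>a s t b. p = a @ s # t # b \<and> s \<notin> T \<and> t \<in> T \<and> E s t" using assms
  proof (induction p)
    case (Cons u p)
    then have p: "p \<noteq> []" by auto
    show ?case
    proof (cases "hd p \<in> T")
      case True
      then show ?thesis using Cons.prems p
        by (intro exI[of _ "[]"] exI[of _ u] exI[of _ "hd p"] exI[of _ "tl p"])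
           (auto simp: walk_Cons)
    next
      case False
      then obtain a s t b where "p = a @ s # t # b \<and> s \<notin> T \<and> t \<in> T \<and> E s t"
        using Cons p by (auto simp: walk_Cons)
      then show ?thesis by (intro exI[of _ "u # a"]) auto
    qed
  qed simp
  then show ?thesis using that by blast
qed

lemma reach_crossing:
  assumes "E\<^sup>*\<^sup>* u v" and "u \<notin> T" and "v \<in> T"
  obtains s t where "E\<^sup>*\<^sup>* u s" and "s \<notin> T" and "E s t" and "t \<in> T" and "E\<^sup>*\<^sup>* t v"
  using assms
proof (induction arbitrary: thesis rule: converse_rtranclp_induct)
  case (step y z)
  show ?case
  proof (cases "z \<in> T")
    case True
    then show ?thesis using step by blast
  next
    case False
    then obtain s t where "E\<^sup>*\<^sup>* z s" "s \<notin> T" "E s t" "t \<in> T" "E\<^sup>*\<^sup>* t v" using step by metis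
    then show ?thesis using step.prems(1)[of s t] step.hyps(1)
      by (meson converse_rtranclp_into_rtranclp)
  qed
qed simp

text \<open>The bound is the length of the longest test walks: a walk of at most \<open>card V + 2\<close> vertices
  that connects two given vertices, with one further vertex at each end.\<close>

theorem joint_embedding_bounded:
  assumes short: "\<And>p q. walk p \<Longrightarrow> walk q \<Longrightarrow> length p \<le> card V + 4 \<Longrightarrow> length q \<le> card V + 4 \<Longrightarrow>
      \<exists>z. walk z \<and> sublist p z \<and> sublist q z"
    and p: "walk p" and q: "walk q"
  shows "\<exists>z. walk z \<and> sublist p z \<and> sublist q z"
proof (cases "p = [] \<or> q = []")
  case True
  then show ?thesis using p q by (intro exI[of _ "p @ q"]) auto
next
  case False
  then have ne: "p \<noteq> []" "q \<noteq> []" by auto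
  show ?thesis
  proof (cases "\<forall>u\<in>V. \<forall>v\<in>V. E\<^sup>*\<^sup>* u v")
    case True
    have "last p \<in> V" "hd q \<in> V" using p q ne by (auto simp: walk_def)
    then obtain z where "walk z" "prefix p z" "suffix q z"
      using walk_connect[OF p ne(1) q ne(2)] True by blast
    then show ?thesis by blast
  next
    case False
    then obtain a b where ab: "a \<in> V" "b \<in> V" "\<not> E\<^sup>*\<^sup>* a b" by blast
    define T where "T = {w. E\<^sup>*\<^sup>* a w}"
    have T: "\<forall>u v. u \<in> T \<longrightarrow> E u v \<longrightarrow> v \<in> T"
      by (auto simp: T_def)
    \<comment> \<open>one-vertex walks: any two vertices lie on a common walk\<close>
    have compar: "E\<^sup>*\<^sup>* u v \<or> E\<^sup>*\<^sup>* v u" if uv: "u \<in> V" "v \<in> V" for u v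
    proof (cases "u = v")
      case False
      obtain z where z: "walk z" "u \<in> set z" "v \<in> set z"
        using short[of "[u]" "[v]"] uv by (auto simp: walk_Cons dest!: set_mono_sublist)
      then obtain x y where "z = x @ u # y" by (auto simp: in_set_conv_decomp)
      moreover from this z(3) False have "v \<in> set x \<or> v \<in> set y" by auto
      ultimately have "(\<exists>x' g y'. z = x' @ v # g @ u # y') \<or> (\<exists>x' g y'. z = x' @ u # g @ v # y')"
        by (auto simp: in_set_conv_decomp) (metis append.assoc append_Cons)+
      then show ?thesis using walk_reach_between z(1) by (metis tranclp_into_rtranclp)
    qed simp
    have to_a: "E\<^sup>*\<^sup>* w a" if "w \<in> V" "w \<notin> T" for w
      using compar[of w a] that ab(1) by (auto simp: T_def)
    have bT: "b \<notin> T" "a \<in> T" using ab by (auto simp: T_def)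
    obtain s t where st: "s \<notin> T" "E s t" "t \<in> T"
      using reach_crossing[OF to_a[OF ab(2) bT(1)] bT] by blast
    have st_V: "s \<in> V" "t \<in> V" using E_in_V st by blast+
    \<comment> \<open>two crossing edges on a common walk coincide\<close>
    have uniq: "s' = s \<and> t' = t" if e: "s' \<notin> T" "E s' t'" "t' \<in> T" for s' t'
    proof -
      obtain z where "walk z" "sublist ([] @ s' # t' # []) z" "sublist ([] @ s # t # []) z"
        using short[of "[s', t']" "[s, t]"] e st E_in_V[of s' t'] st_V by (auto simp: walk_Cons)
      then show ?thesis using cut_alignment[OF T] e st by blast
    qed
    have to_s: "E\<^sup>*\<^sup>* w s" if "w \<in> V" "w \<notin> T" for w
      using reach_crossing[OF to_a[OF that] that(2) bT(2)] uniq by metis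
    have from_t: "E\<^sup>*\<^sup>* t w" if "w \<in> T" for w
    proof -
      have "E\<^sup>*\<^sup>* b w" using to_a[OF ab(2) bT(1)] that by (auto simp: T_def)
      then show ?thesis using reach_crossing[OF _ bT(1) that] uniq by metis
    qed
    \<comment> \<open>two ways to continue behind the crossing, tested behind a short route from the crossing to the vertex\<close>
    have T_det: "v1 = v2 \<and> v1 \<in> T" if e: "w \<in> T" "E w v1" "E w v2" for w v1 v2
    proof -
      obtain h where h: "walk h" "h \<noteq> []" "hd h = t" "last h = w" "length h \<le> card V + 2"
        using reach_walk[OF from_t[OF e(1)] st_V(2)] .
      then obtain h' where h': "h = t # h'" by (cases h) auto
      have wk: "walk ([] @ s # t # (h' @ [v]))" if wv: "E w v" for v
        using h st st_V wv E_in_V[OF wv] by (auto simp: h' walk_Cons walk_append hd_append)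
      obtain z where "walk z" "sublist ([] @ s # t # (h' @ [v1])) z"
          "sublist ([] @ s # t # (h' @ [v2])) z"
        using short[OF wk[OF e(2)] wk[OF e(3)]] h(5) by (auto simp: h')
      then have "prefix (h' @ [v1]) (h' @ [v2]) \<or> prefix (h' @ [v2]) (h' @ [v1])"
        using cut_alignment[OF T] st by blast
      then show ?thesis using T e by auto
    qed
    \<comment> \<open>the mirror image: two ways to arrive in front of the crossing\<close>
    have S_det: "v1 = v2 \<and> v1 \<in> V - T" if e: "w \<in> V - T" "E v1 w" "E v2 w" for w v1 v2
    proof -
      have w: "E\<^sup>*\<^sup>* w s" "w \<in> V" using to_s e(1) by auto
      obtain h where h: "walk h" "h \<noteq> []" "hd h = w" "last h = s" "length h \<le> card V + 2"
        using reach_walk[OF w] .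
      then obtain h' where h': "h = h' @ [s]" by (cases h rule: rev_cases) auto
      have wk: "walk ((v # h') @ s # t # [])" if vw: "E v w" for v
        using h st st_V vw E_in_V[OF vw]
        by (auto simp: h' walk_Cons walk_append hd_append split: if_splits)
      obtain z where "walk z" "sublist ((v1 # h') @ s # t # []) z"
          "sublist ((v2 # h') @ s # t # []) z"
        using short[OF wk[OF e(2)] wk[OF e(3)]] h(5) by (auto simp: h')
      then have "suffix (v1 # h') (v2 # h') \<or> suffix (v2 # h') (v1 # h')"
        using cut_alignment[OF T] st by blast
      then have "v1 = v2" by (auto dest!: suffix_length_le suffix_order.antisym simp: suffix_def)
      then show ?thesis using T e E_in_V[of v1 w] by auto
    qed
    \<comment> \<open>every walk can be prolonged to one that uses the crossing edge\<close>
    have extend: "\<exists>\<alpha> \<beta>. walk (\<alpha> @ s # t # \<beta>) \<and> sublist x (\<alpha> @ s # t # \<beta>)"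
      if x: "walk x" "x \<noteq> []" for x
    proof -
      have st_walk: "walk [s, t]" using st st_V by (simp add: walk_Cons)
      have x_V: "hd x \<in> V" "last x \<in> V" using x by (auto simp: walk_def)
      consider "hd x \<in> T" | "last x \<notin> T" | "hd x \<notin> T" "last x \<in> T" by blast
      then show ?thesis
      proof cases
        case 1
        then obtain z where "walk z" "prefix [s, t] z" "suffix x z"
          using walk_connect[OF st_walk _ x] from_t by auto
        then show ?thesis by (intro exI[of _ "[]"] exI[of _ "drop 2 z"]) (auto simp: prefix_def)
      next
        case 2
        then obtain z where "walk z" "prefix x z" "suffix [s, t] z"
          using walk_connect[OF x st_walk] to_s x_V by auto
        then show ?thesis by (auto simp: suffix_def)
      next
        case 3
        then obtain \<alpha> s' t' \<beta> where "x = \<alpha> @ s' # t' # \<beta>" "s' \<notin> T" "t' \<in> T" "E s' t'"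
          using walk_crossing[OF x] by blast
        then show ?thesis using uniq x by blast
      qed
    qed
    obtain \<alpha> \<beta> where p': "walk (\<alpha> @ s # t # \<beta>)" "sublist p (\<alpha> @ s # t # \<beta>)"
      using extend[OF p ne(1)] by blast
    obtain \<alpha>' \<beta>' where q': "walk (\<alpha>' @ s # t # \<beta>')" "sublist q (\<alpha>' @ s # t # \<beta>')"
      using extend[OF q ne(2)] by blast
    have "suffix \<alpha> \<alpha>' \<or> suffix \<alpha>' \<alpha>"
      using p'(1) q'(1) st st_V
      by (intro backward_deterministic[of "V - T" \<alpha> s \<alpha>'] S_det) (auto simp: walk_append walk_Cons)
    then obtain \<gamma> where \<gamma>: "suffix \<alpha> \<gamma>" "suffix \<alpha>' \<gamma>" "\<gamma> = \<alpha> \<or> \<gamma> = \<alpha>'" by auto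
    have "prefix \<beta> \<beta>' \<or> prefix \<beta>' \<beta>"
      using p'(1) q'(1) st st_V
      by (intro forward_deterministic[of T t \<beta> \<beta>'] T_det) (auto simp: walk_append walk_Cons)
    then obtain \<delta> where \<delta>: "prefix \<beta> \<delta>" "prefix \<beta>' \<delta>" "\<delta> = \<beta> \<or> \<delta> = \<beta>'" by auto
    have "walk (\<gamma> @ s # t # \<delta>)"
      using p'(1) q'(1) \<gamma>(3) \<delta>(3) by (auto simp: walk_append walk_Cons)
    moreover have "sublist p (\<gamma> @ s # t # \<delta>)"
    proof (rule sublist_order.order_trans[OF p'(2)])
      show "sublist (\<alpha> @ s # t # \<beta>) (\<gamma> @ s # t # \<delta>)"
        using \<gamma>(1) \<delta>(1) by (auto simp: suffix_def prefix_def sublist_def) (metis append_Cons append_assoc)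
    qed
    moreover have "sublist q (\<gamma> @ s # t # \<delta>)"
    proof (rule sublist_order.order_trans[OF q'(2)])
      show "sublist (\<alpha>' @ s # t # \<beta>') (\<gamma> @ s # t # \<delta>)"
        using \<gamma>(2) \<delta>(2) by (auto simp: suffix_def prefix_def sublist_def) (metis append_Cons append_assoc)
    qed
    ultimately show ?thesis by blast
  qed
qed

end

section \<open>Antichains of walks\<close>

text \<open>Fix an element \<open>q\<close>. In an antichain, every element lies on one of the finitely many lines where the
  first or the second coordinate is at most that of \<open>q\<close>, and each line is a chain.\<close>

lemma infinite_nat_pairs_comparable:
  fixes X :: "(nat \<times> nat) set"
  assumes "infinite X"
  shows "\<exists>p\<in>X. \<exists>q\<in>X. p \<noteq> q \<and> fst p \<le> fst q \<and> snd p \<le> snd q"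
proof (rule ccontr)
  assume "\<not> ?thesis"
  then have anti: "p = q" if "p \<in> X" "q \<in> X" "fst p \<le> fst q" "snd p \<le> snd q" for p q
    using that by blast
  have single: "finite S" if eq: "\<And>p q. p \<in> S \<Longrightarrow> q \<in> S \<Longrightarrow> p = q" for S :: "(nat \<times> nat) set"
  proof (cases "S = {}")
    case False
    then obtain p where "p \<in> S" by blast
    then have "S \<subseteq> {p}" using eq by blast
    then show ?thesis by (rule finite_subset) simp
  qed simp
  have fin1: "finite {p\<in>X. fst p = i}" for i
  proof (rule single)
    show "p = q" if "p \<in> {p\<in>X. fst p = i}" "q \<in> {p\<in>X. fst p = i}" for p q
      using that anti[of p q] anti[of q p] by (cases "snd p \<le> snd q") auto
  qed
  have fin2: "finite {p\<in>X. snd p = i}" for i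
  proof (rule single)
    show "p = q" if "p \<in> {p\<in>X. snd p = i}" "q \<in> {p\<in>X. snd p = i}" for p q
      using that anti[of p q] anti[of q p] by (cases "fst p \<le> fst q") auto
  qed
  from assms obtain q where q: "q \<in> X" using infinite_imp_nonempty by blast
  have "X \<subseteq> (\<Union>i\<le>fst q. {p\<in>X. fst p = i}) \<union> (\<Union>i\<le>snd q. {p\<in>X. snd p = i})"
  proof
    fix p assume "p \<in> X"
    then show "p \<in> (\<Union>i\<le>fst q. {p\<in>X. fst p = i}) \<union> (\<Union>i\<le>snd q. {p\<in>X. snd p = i})"
      using anti[OF q, of p] by (cases "fst p \<le> fst q"; cases "snd p \<le> snd q") auto
  qed
  moreover have "finite ((\<Union>i\<le>fst q. {p\<in>X. fst p = i}) \<union> (\<Union>i\<le>snd q. {p\<in>X. snd p = i}))"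
    using fin1 fin2 by (intro finite_UnI finite_UN_I) auto
  ultimately show False using assms finite_subset by blast
qed

lemma mod_add_left_cancel:
  assumes "0 < (l :: nat)" shows "(a + m) mod l = (a + n) mod l \<longleftrightarrow> m mod l = n mod l"
proof
  have l: "(l - 1) * a + (a + k) = k + l * a" for k
    using assms by (cases l) auto
  assume "(a + m) mod l = (a + n) mod l"
  then have "((l - 1) * a + (a + m)) mod l = ((l - 1) * a + (a + n)) mod l"
    by (rule mod_add_cong[OF refl])
  then show "m mod l = n mod l" by (simp only: l mod_mult_self2)
qed (rule mod_add_cong[OF refl])

text \<open>The sequence \<open>t\<close> runs round a simple cycle of length \<open>l\<close>; the letter \<open>a\<close> enters it at \<open>t 0\<close> and \<open>b\<close>
  leaves it behind a position congruent to \<open>J\<close>. In an embedding at offset zero the final \<open>b\<close>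
  meets the continuation of the cycle. At a positive offset, the vertex after \<open>a\<close> fixes the phase,
  so that \<open>a\<close> meets the cyclic predecessor of \<open>t 0\<close>.\<close>

lemma pumped_words_incomparable:
  assumes period: "\<And>m n. t m = t n \<longleftrightarrow> m mod l = n mod l" and l: "0 < l"
    and a: "a \<noteq> t (l - 1)" and b: "b \<noteq> t (Suc J)" and ij: "i \<noteq> j"
  shows "\<not> sublist (a # map t [0..<Suc (J + i * l)] @ [b]) (a # map t [0..<Suc (J + j * l)] @ [b])"
proof
  define w where "w k = a # map t [0..<Suc (J + k * l)] @ [b]" for k
  have len: "length (w k) = J + k * l + 3" for k by (simp add: w_def)
  have nth: "w k ! 0 = a" "w k ! Suc (Suc (J + k * l)) = b" for k
    by (simp_all add: w_def nth_append)
  have nth_t: "w k ! Suc n = t n" if "n < Suc (J + k * l)" for k n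
    using that by (simp add: w_def nth_append del: upt_Suc)
  assume "sublist (a # map t [0..<Suc (J + i * l)] @ [b]) (a # map t [0..<Suc (J + j * l)] @ [b])"
  then obtain p s where ps: "w j = p @ w i @ s" by (auto simp: w_def sublist_def)
  have shift: "w j ! (length p + n) = w i ! n" if "n < length (w i)" for n
    using that by (simp add: ps nth_append)
  have "length (w i) \<le> length (w j)" by (simp add: ps)
  then have "i * l < j * l" using ij l by (auto simp: len)
  show False
  proof (cases "length p")
    case 0
    have "w j ! Suc (Suc (J + i * l)) = b"
      using shift[of "Suc (Suc (J + i * l))"] 0 by (simp add: len nth)
    then have "t (Suc (J + i * l)) = b"
      using nth_t[of "Suc (J + i * l)" j] \<open>i * l < j * l\<close> by simp
    moreover have "t (Suc (J + i * l)) = t (Suc J)"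
      unfolding period by (metis add_Suc mod_mult_self1)
    ultimately show False using b by simp
  next
    case (Suc d)
    have "length (w j) = length p + length (w i) + length s" by (simp add: ps)
    then have d: "Suc d < Suc (J + j * l)" by (simp add: len Suc)
    have "t (Suc d) = t 0"
      using shift[of 1] nth_t[OF d] nth_t[of 0 i] by (simp add: len Suc)
    then have "Suc d mod l = 0" by (simp add: period)
    then have "d mod l = l - 1" using l by (metis Suc_eq_plus1 diff_Suc_1 mod_Suc nat.distinct(1))
    then have "t d = t (l - 1)" using l by (simp add: period)
    moreover have "t d = a" using shift[of 0] nth_t[of d j] d by (simp add: len Suc nth)
    ultimately show False using a by simp
  qed
qed

context finite_digraph
begin

definition out_branching :: "'a \<Rightarrow> bool" where
  "out_branching u \<longleftrightarrow> (\<exists>v w. E u v \<and> E u w \<and> v \<noteq> w)"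

definition in_branching :: "'a \<Rightarrow> bool" where
  "in_branching u \<longleftrightarrow> (\<exists>v w. E v u \<and> E w u \<and> v \<noteq> w)"

text \<open>From a backward determined vertex, walks can be traced back in only one way, because no branching is
  met on any route into it; dually for forward determined vertices.\<close>

definition backward_determined :: "'a set" where
  "backward_determined = {v. \<forall>y. E\<^sup>*\<^sup>* y v \<longrightarrow> \<not> in_branching y}"

definition forward_determined :: "'a set" where
  "forward_determined = {v. \<forall>x. E\<^sup>*\<^sup>* v x \<longrightarrow> \<not> out_branching x}"

text \<open>The closed walk through \<open>v\<close> is arbitrary, and the branchings may lie away from it. This form
  refers to reachability alone, which makes it easy to test; a simple cycle with an entry and an exit is
  extracted from it in \<open>walk_antichain_infinite\<close>.\<close>

definition in_out_cycle :: bool where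
  "in_out_cycle \<longleftrightarrow> (\<exists>v. E\<^sup>+\<^sup>+ v v \<and> (\<exists>x. E\<^sup>+\<^sup>+ v x \<and> out_branching x) \<and>
     (\<exists>y. E\<^sup>+\<^sup>+ y v \<and> in_branching y))"

lemma walk_reach_from_hd:
  assumes "walk p" and "u \<in> set p" shows "E\<^sup>*\<^sup>* (hd p) u"
proof -
  from assms(2) obtain a b where p: "p = (a @ [u]) @ b" by (auto simp: in_set_conv_decomp)
  then have "walk (a @ [u])" using assms(1) by (auto simp only: walk_append)
  from walk_reach[OF this] show ?thesis by (cases "a = []") (simp_all add: p)
qed

text \<open>Backward determined vertices form an initial segment of a walk and forward determined ones a final
  segment. A vertex that is neither lies on no closed walk, for otherwise branchings
  before and behind that closed walk would make an in-out cycle; so the vertices in between are pairwise distinct.\<close>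

lemma walk_decomposition:
  assumes no: "\<not> in_out_cycle" and p: "walk p"
  shows "\<exists>\<alpha> \<mu> \<beta>. \<alpha> @ \<mu> @ \<beta> = p \<and> distinct \<mu> \<and>
    set \<alpha> \<subseteq> backward_determined \<and> set \<beta> \<subseteq> forward_determined"
proof -
  let ?B = backward_determined
  let ?F = forward_determined
  have B: "u \<in> ?B" if "E\<^sup>*\<^sup>* u v" "v \<in> ?B" for u v
    using that unfolding backward_determined_def by (auto intro: rtranclp_trans)
  have F: "v \<in> ?F" if "E\<^sup>*\<^sup>* u v" "u \<in> ?F" for u v
    using that unfolding forward_determined_def by (auto intro: rtranclp_trans)
  define \<alpha> where "\<alpha> = takeWhile (\<lambda>v. v \<in> ?B) p"
  define r where "r = dropWhile (\<lambda>v. v \<in> ?B) p"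
  define \<mu> where "\<mu> = takeWhile (\<lambda>v. v \<notin> ?F) r"
  define \<beta> where "\<beta> = dropWhile (\<lambda>v. v \<notin> ?F) r"
  have p_eq: "p = \<alpha> @ r" and r_eq: "r = \<mu> @ \<beta>" by (simp_all add: \<alpha>_def r_def \<mu>_def \<beta>_def)
  have walks: "walk r" "walk \<mu>" "walk \<beta>" using p by (auto simp: p_eq r_eq walk_append)
  have "set \<alpha> \<subseteq> ?B" by (auto simp: \<alpha>_def dest: set_takeWhileD)
  have r_B: "u \<notin> ?B" if "u \<in> set r" for u
  proof -
    have "r \<noteq> []" using that by auto
    then have "hd r \<notin> ?B" unfolding r_def by (rule hd_dropWhile)
    then show ?thesis using B walk_reach_from_hd[OF walks(1) that] by blast
  qed
  have "u \<in> ?F" if "u \<in> set \<beta>" for u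
  proof -
    have "\<beta> \<noteq> []" using that by auto
    then have "hd \<beta> \<in> ?F" unfolding \<beta>_def using hd_dropWhile[of "\<lambda>v. v \<notin> ?F" r] by blast
    then show ?thesis using F walk_reach_from_hd[OF walks(3) that] by blast
  qed
  have "distinct \<mu>"
  proof (rule ccontr)
    assume "\<not> distinct \<mu>"
    then obtain a v b c where \<mu>: "\<mu> = a @ [v] @ b @ [v] @ c" using not_distinct_decomp by blast
    then have cyc: "E\<^sup>+\<^sup>+ v v" using walk_reach_between[of a v b v c] walks(2) by simp
    have v: "v \<in> set \<mu>" using \<mu> by simp
    then have "v \<notin> ?B" using r_B r_eq by simp
    moreover have "v \<notin> ?F" using v set_takeWhileD[of v "\<lambda>v. v \<notin> ?F" r] by (simp add: \<mu>_def)
    ultimately obtain x y where "E\<^sup>*\<^sup>* y v" "in_branching y" "E\<^sup>*\<^sup>* v x" "out_branching x"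
      unfolding backward_determined_def forward_determined_def by auto
    then show False using no cyc unfolding in_out_cycle_def
      by (meson rtranclp_tranclp_tranclp tranclp_rtranclp_tranclp)
  qed
  then show ?thesis
    using p_eq r_eq \<open>set \<alpha> \<subseteq> ?B\<close> \<open>\<And>u. u \<in> set \<beta> \<Longrightarrow> u \<in> ?F\<close> by blast
qed

text \<open>The type of a walk records the inner end points of the two determined pieces and the whole middle
  piece; there are finitely many types. Among walks of one type, longer outer pieces extend shorter
  ones.\<close>

theorem walk_antichain_finite:
  assumes no: "\<not> in_out_cycle" and X: "\<And>p. p \<in> X \<Longrightarrow> walk p"
    and anti: "\<And>p q. p \<in> X \<Longrightarrow> q \<in> X \<Longrightarrow> sublist p q \<Longrightarrow> p = q"
  shows "finite X"
proof (rule ccontr)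
  assume inf: "infinite X"
  let ?B = backward_determined
  let ?F = forward_determined
  have B: "v = w \<and> v \<in> ?B" if "u \<in> ?B" "E v u" "E w u" for u v w
    using that unfolding backward_determined_def in_branching_def by (blast intro: rtranclp.rtrancl_into_rtrancl)
  have F: "v = w \<and> v \<in> ?F" if "u \<in> ?F" "E u v" "E u w" for u v w
    using that unfolding forward_determined_def out_branching_def by (blast intro: converse_rtranclp_into_rtranclp)
  define D where "D p \<alpha> \<mu> \<beta> \<longleftrightarrow> \<alpha> @ \<mu> @ \<beta> = p \<and> distinct \<mu> \<and> set \<alpha> \<subseteq> ?B \<and> set \<beta> \<subseteq> ?F"
    for p \<alpha> \<mu> \<beta>
  have "\<exists>\<alpha> \<mu> \<beta>. D p \<alpha> \<mu> \<beta>" if "p \<in> X" for p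
    unfolding D_def by (rule walk_decomposition[OF no X[OF that]])
  then obtain \<alpha> \<mu> \<beta> where "\<forall>p. p \<in> X \<longrightarrow> D p (\<alpha> p) (\<mu> p) (\<beta> p)" by metis
  then have dec: "\<alpha> p @ \<mu> p @ \<beta> p = p" "distinct (\<mu> p)" "set (\<alpha> p) \<subseteq> ?B" "set (\<beta> p) \<subseteq> ?F"
    if "p \<in> X" for p
    using that by (auto simp: D_def)
  \<comment> \<open>the lists for the end points are empty if the piece is empty, and singletons otherwise\<close>
  define \<tau> where "\<tau> p = (drop (length (\<alpha> p) - 1) (\<alpha> p), \<mu> p, take 1 (\<beta> p))" for p
  define L where "L = {xs. set xs \<subseteq> V \<and> length xs \<le> card V + 1}"
  have walks: "walk (\<alpha> p)" "walk (\<mu> p)" "walk (\<beta> p)" if "p \<in> X" for p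
    using X[OF that] dec(1)[OF that] walk_append by metis+
  have "\<tau> p \<in> L \<times> L \<times> L" if "p \<in> X" for p
  proof -
    have "length (\<mu> p) \<le> card V"
      using walks(2)[OF that] dec(2)[OF that] card_mono[OF finite_V, of "set (\<mu> p)"]
      by (simp add: walk_def distinct_card)
    then show ?thesis
      using walks[OF that] set_drop_subset[of "length (\<alpha> p) - 1" "\<alpha> p"]
        set_take_subset[of 1 "\<beta> p"]
      by (auto simp: \<tau>_def L_def walk_def)
  qed
  moreover have "finite L" unfolding L_def by (rule finite_lists_length_le[OF finite_V])
  ultimately have "finite (\<tau> ` X)" by (meson finite_SigmaI finite_subset image_subsetI)
  then obtain p0 where "infinite {p\<in>X. \<tau> p = \<tau> p0}" using pigeonhole_infinite[OF inf] by blast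
  define Y where "Y = {p\<in>X. \<tau> p = \<tau> p0}"
  have comparable: "sublist p q"
    if pq: "p \<in> Y" "q \<in> Y" "length (\<alpha> p) \<le> length (\<alpha> q)" "length (\<beta> p) \<le> length (\<beta> q)" for p q
  proof -
    have in_X: "p \<in> X" "q \<in> X" and \<tau>: "\<tau> p = \<tau> q" using pq by (auto simp: Y_def)
    have "suffix (\<alpha> p) (\<alpha> q)"
    proof (cases "\<alpha> p" rule: rev_cases)
      case (snoc a u)
      then obtain b where b: "\<alpha> q = b @ [u]"
        using \<tau> pq(3) by (cases "\<alpha> q" rule: rev_cases) (auto simp: \<tau>_def)
      have "suffix a b \<or> suffix b a"
        using backward_deterministic[of ?B a u b] B walks(1) in_X dec(3)[OF in_X(1)] snoc b by force
      then have "suffix a b"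
        using pq(3) snoc b by (auto simp: suffix_def)
      then show ?thesis using snoc b by (auto simp: suffix_def)
    qed simp
    moreover have "prefix (\<beta> p) (\<beta> q)"
    proof (cases "\<beta> p")
      case (Cons u a)
      then obtain b where b: "\<beta> q = u # b"
        using \<tau> pq(4) by (cases "\<beta> q") (auto simp: \<tau>_def)
      have "prefix a b \<or> prefix b a"
        using forward_deterministic[of ?F u a b] F walks(3) in_X dec(4)[OF in_X(1)] Cons b by force
      then have "prefix a b"
        using pq(4) Cons b by (auto simp: prefix_def)
      then show ?thesis using Cons b by simp
    qed simp
    moreover have "\<mu> p = \<mu> q" using \<tau> by (simp add: \<tau>_def)
    moreover obtain x y where "\<alpha> q = x @ \<alpha> p" "\<beta> q = \<beta> p @ y"
      using calculation by (auto simp: suffix_def prefix_def)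
    ultimately have "q = x @ (\<alpha> p @ \<mu> p @ \<beta> p) @ y"
      using dec(1)[OF in_X(2)] by simp
    then show ?thesis using dec(1)[OF in_X(1)] by simp
  qed
  define g where "g p = (length (\<alpha> p), length (\<beta> p))" for p
  have "inj_on g Y"
    using comparable anti unfolding inj_on_def g_def Y_def by auto
  then have "infinite (g ` Y)"
    using \<open>infinite {p\<in>X. \<tau> p = \<tau> p0}\<close> by (simp add: finite_image_iff Y_def)
  from infinite_nat_pairs_comparable[OF this] obtain p q
    where "p \<in> Y" "q \<in> Y" "g p \<noteq> g q" "length (\<alpha> p) \<le> length (\<alpha> q)" "length (\<beta> p) \<le> length (\<beta> q)"
    by (auto simp: g_def)
  then show False using comparable[of p q] anti[of p q] by (auto simp: Y_def)
qed

text \<open>A shortest closed walk through \<open>v\<close> repeats no vertex. It is presented as a periodic sequence.\<close>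

lemma simple_cycle:
  assumes "E\<^sup>+\<^sup>+ v v"
  obtains s :: "nat \<Rightarrow> 'a" and l where "0 < l" and "s 0 = v" and "\<And>i. E (s i) (s (Suc i))"
    and "\<And>m n. s m = s n \<longleftrightarrow> m mod l = n mod l"
proof -
  obtain g where g: "walk (v # g @ [v])" and least: "\<And>g'. walk (v # g' @ [v]) \<Longrightarrow> length g \<le> length g'"
  proof -
    from assms obtain g0 where "walk (v # g0 @ [v])" by (auto simp: tranclp_iff_walk)
    from ex_has_least_nat[of "\<lambda>g. walk (v # g @ [v])", OF this] show thesis using that by blast
  qed
  have "v \<notin> set g"
  proof
    assume "v \<in> set g"
    then obtain a b where ab: "g = a @ v # b" by (auto simp: in_set_conv_decomp)
    then have "walk (v # a @ [v])" using g by (intro walk_sublist[OF g]) auto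
    then show False using least ab by fastforce
  qed
  moreover have "distinct g"
  proof (rule ccontr)
    assume "\<not> distinct g"
    then obtain a u b c where ab: "g = a @ [u] @ b @ [u] @ c" using not_distinct_decomp by blast
    then have "walk (v # (a @ u # c) @ [v])" using g walk_cut[of "v # a" u b "c @ [v]"] by simp
    then show False using least ab by fastforce
  qed
  ultimately have dist: "distinct (v # g)" by simp
  define l where "l = length (v # g)"
  define s where "s i = (v # g) ! (i mod l)" for i
  have l: "0 < l" by (simp add: l_def)
  have "E (s i) (s (Suc i))" for i
  proof -
    have i: "i mod l < l" using l by simp
    have "E ((v # g @ [v]) ! n) ((v # g @ [v]) ! Suc n)" if "n < l" for n
      using g that by (auto simp: walk_def successively_conv_nth l_def)
    moreover have app: "(v # g @ [v]) ! n = (if n < l then (v # g) ! n else v)" if "n \<le> l" for n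
      using that nth_append[of "v # g" "[v]" n] by (auto simp: l_def)
    moreover have "(v # g @ [v]) ! (i mod l) = s i"
      using app[of "i mod l"] i by (simp add: s_def)
    moreover have "(v # g @ [v]) ! Suc (i mod l) = s (Suc i)"
      using app[of "Suc (i mod l)"] i by (simp add: s_def mod_Suc del: nth_Cons_Suc)
    ultimately show ?thesis using i by metis
  qed
  moreover have "s m = s n \<longleftrightarrow> m mod l = n mod l" for m n
    using dist nth_eq_iff_index_eq[of "v # g" "m mod l" "n mod l"] l by (simp add: s_def l_def)
  moreover have "s 0 = v" by (simp add: s_def)
  ultimately show thesis using that l by blast
qed

theorem walk_antichain_infinite:
  assumes in_out_cycle
  obtains X where "infinite X" and "\<And>p. p \<in> X \<Longrightarrow> walk p \<and> p \<noteq> []"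
    and "\<And>p q. p \<in> X \<Longrightarrow> q \<in> X \<Longrightarrow> p \<noteq> q \<Longrightarrow> \<not> sublist p q"
proof -
  from assms obtain v x y where cyc: "E\<^sup>+\<^sup>+ v v" and x: "E\<^sup>+\<^sup>+ v x" "out_branching x"
    and y: "E\<^sup>+\<^sup>+ y v" "in_branching y"
    unfolding in_out_cycle_def by blast
  obtain s l where l: "0 < (l :: nat)" and s0: "s 0 = v" and sE: "\<And>i. E (s i) (s (Suc i))"
    and period: "\<And>m n. s m = s n \<longleftrightarrow> m mod l = n mod l"
    using simple_cycle[OF cyc] by blast
  \<comment> \<open>without an exit the cycle is all that can be reached from \<open>v\<close>, yet a branching vertex is reached\<close>
  have "\<exists>j b. E (s j) b \<and> b \<noteq> s (Suc j)"
  proof (rule ccontr)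
    assume no_exit: "\<not> ?thesis"
    have "x \<in> range s" using x(1)
      by (induction rule: tranclp_induct) (use no_exit s0 in blast)+
    then show False using x(2) no_exit unfolding out_branching_def by blast
  qed
  then obtain j b where b: "E (s j) b" "b \<noteq> s (Suc j)" by blast
  have pred: "s (Suc (i + l - 1)) = s i" for i using l by (simp add: period)
  \<comment> \<open>the same argument backwards; indices are shifted by a period to write every cycle vertex as a successor\<close>
  have "\<exists>i a. E a (s (Suc i)) \<and> a \<noteq> s i"
  proof (rule ccontr)
    assume no_entry: "\<not> ?thesis"
    have "y \<in> range s" using y(1)
      by (induction rule: converse_tranclp_induct) (use no_entry s0 pred in \<open>metis rangeI rangeE\<close>)+
    then show False using y(2) no_entry pred unfolding in_branching_def by (metis rangeE)
  qed
  then obtain i a where a: "E a (s (Suc i))" "a \<noteq> s i" by blast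
  \<comment> \<open>\<open>t\<close> starts at the entry; \<open>J\<close> is an index of the exit vertex \<open>s j\<close> on this shifted sequence\<close>
  define t where "t n = s (Suc i + n)" for n
  define J where "J = j + (l - 1) * Suc i"
  have J: "Suc i + J = j + l * Suc i" using l by (cases l) (auto simp: J_def)
  have t_period: "t m = t n \<longleftrightarrow> m mod l = n mod l" for m n
    unfolding t_def period by (rule mod_add_left_cancel[OF l])
  have tE: "E (t n) (t (Suc n))" for n using sE by (simp add: t_def)
  have tb: "E (t J) b" "b \<noteq> t (Suc J)"
  proof -
    have "t J = s j" "t (Suc J) = s (Suc j)"
      unfolding t_def period add_Suc_right J by (simp_all only: mod_mult_self2 flip: add_Suc)
    then show "E (t J) b" "b \<noteq> t (Suc J)" using b by auto
  qed
  have ta: "E a (t 0)" "a \<noteq> t (l - 1)" using a l by (auto simp: t_def period)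
  define w where "w k = a # map t [0..<Suc (J + k * l)] @ [b]" for k
  have t_walk: "walk (map t [0..<n])" for n
  proof (induction n)
    case (Suc n)
    then show ?case using tE[of "n - 1"] E_in_V[OF tE[of n]]
      by (cases n) (auto simp: walk_append walk_Cons)
  qed simp
  have walk_w: "walk (w k)" for k
  proof -
    have "t (J + k * l) = t J" by (simp add: t_period)
    then have "walk (map t [0..<Suc (J + k * l)] @ [b])"
      unfolding walk_append using t_walk[of "Suc (J + k * l)"] tb E_in_V[OF tb(1)]
      by (auto simp: walk_Cons)
    moreover have "hd (map t [0..<Suc (J + k * l)] @ [b]) = t 0"
      by (simp add: upt_conv_Cons del: upt_Suc)
    ultimately show ?thesis unfolding w_def using ta E_in_V[OF ta(1)] by (simp only: walk_Cons) simp
  qed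
  have inc: "\<not> sublist (w m) (w n)" if "m \<noteq> n" for m n
    unfolding w_def by (rule pumped_words_incomparable[OF t_period l ta(2) tb(2) that])
  have "inj w" using inc by (metis injI sublist_order.order_refl)
  show thesis
  proof (rule that[of "range w"])
    show "infinite (range w)" using \<open>inj w\<close> by (simp add: finite_image_iff)
    show "walk p \<and> p \<noteq> []" if "p \<in> range w" for p
    proof -
      from that obtain k where "p = w k" by (rule rangeE)
      then show ?thesis using walk_w[of k] by (simp add: w_def)
    qed
    show "\<not> sublist p q" if "p \<in> range w" "q \<in> range w" "p \<noteq> q" for p q
      using that inc by (metis rangeE)
  qed
qed

end

section \<open>Words as walks\<close>

text \<open>The factors of length \<open>m\<close>, from left to right; there are none if the word is shorter than \<open>m\<close>.\<close>

primrec windows :: "nat \<Rightarrow> 'a list \<Rightarrow> 'a list list" where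
  "windows m [] = []"
| "windows m (a # x) = (if m \<le> length (a # x) then take m (a # x) # windows m x else [])"

lemma windows_eq_Nil_iff: "0 < m \<Longrightarrow> windows m x = [] \<longleftrightarrow> length x < m"
  by (cases x) auto

lemma hd_windows: "0 < m \<Longrightarrow> m \<le> length x \<Longrightarrow> hd (windows m x) = take m x"
  by (cases x) auto

lemma last_windows: "0 < m \<Longrightarrow> m \<le> length x \<Longrightarrow> last (windows m x) = drop (length x - m) x"
proof (induction x)
  case (Cons a x)
  show ?case
  proof (cases "m \<le> length x")
    case True
    then show ?thesis using Cons by (simp add: windows_eq_Nil_iff Suc_diff_le)
  next
    case False
    then have "m = Suc (length x)" using Cons.prems by simp
    then show ?thesis using windows_eq_Nil_iff[of m x] by simp
  qed
qed simp

lemma length_windows: "0 < m \<Longrightarrow> length (windows m x) = Suc (length x) - m"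
  by (induction x) auto

lemma windows_prefix: "0 < m \<Longrightarrow> prefix x y \<Longrightarrow> prefix (windows m x) (windows m y)"
proof (induction x arbitrary: y)
  case (Cons a x)
  then obtain y' where y: "y = a # y'" "prefix x y'" by (cases y) auto
  then have "take m (a # x) = take m (a # y')" if "m \<le> length (a # x)"
    using that y(2) by (cases m) (auto simp: prefix_def)
  then show ?case using Cons y prefix_length_le[OF y(2)] by auto
qed simp

lemma windows_suffix: "0 < m \<Longrightarrow> suffix (windows m y) (windows m (p @ y))"
proof (induction p)
  case (Cons a p)
  show ?case
  proof (cases "m \<le> length (a # p @ y)")
    case True
    then show ?thesis using Cons by (simp add: suffix_ConsI)
  next
    case False
    then show ?thesis using Cons.prems windows_eq_Nil_iff[of m y] by simp
  qed
qed simp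

text \<open>A word is recovered from its windows: their first letters, followed by the last window.\<close>

lemma windows_prefix_cancel:
  "0 < m \<Longrightarrow> m \<le> length x \<Longrightarrow> prefix (windows m x) (windows m y) \<Longrightarrow> prefix x y"
proof (induction x arbitrary: y)
  case (Cons a x)
  then obtain b y' where y: "y = b # y'" "m \<le> length y" by (cases y) (auto split: if_splits)
  have eq: "take m (a # x) = take m y" and tail: "prefix (windows m x) (windows m y')"
    using Cons.prems y by auto
  show ?case
  proof (cases "m \<le> length x")
    case True
    then have "prefix x y'" using Cons.IH Cons.prems(1) tail by blast
    moreover have "a = b" using eq y(1) Cons.prems(1) by (cases m) auto
    ultimately show ?thesis using y(1) by simp
  next
    case False
    then have "take m (a # x) = a # x" using Cons.prems by simp
    then show ?thesis using eq by (metis take_is_prefix)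
  qed
qed simp

lemma sublist_windows_iff:
  assumes m: "0 < m" and x: "m \<le> length x"
  shows "sublist (windows m x) (windows m y) \<longleftrightarrow> sublist x y"
proof
  assume "sublist x y"
  then obtain z where "suffix z y" "prefix x z" by (auto simp: sublist_altdef')
  then have "suffix (windows m z) (windows m y)" "prefix (windows m x) (windows m z)"
    using windows_suffix[OF m] windows_prefix[OF m] by (auto simp: suffix_def)
  then show "sublist (windows m x) (windows m y)" by (auto simp: sublist_altdef')
next
  show "sublist (windows m x) (windows m y) \<Longrightarrow> sublist x y"
  proof (induction y)
    case Nil
    then show ?case using windows_eq_Nil_iff[OF m, of x] x by simp
  next
    case (Cons b y)
    have "windows m x \<noteq> []" using windows_eq_Nil_iff[OF m, of x] x by simp
    then have "m \<le> length (b # y)" using Cons.prems by (auto split: if_splits)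
    then have "prefix (windows m x) (windows m (b # y)) \<or> sublist (windows m x) (windows m y)"
      using Cons.prems by (simp add: sublist_Cons_right)
    then show ?case
      using windows_prefix_cancel[OF m x, of "b # y"] Cons.IH
      by (auto simp: sublist_Cons_right)
  qed
qed

lemma inj_on_windows: "0 < m \<Longrightarrow> inj_on (windows m) {x. m \<le> length x}"
  by (rule inj_onI) (metis mem_Collect_eq sublist_order.order_antisym sublist_order.order_refl sublist_windows_iff)

text \<open>A factor can be widened inside the surrounding word to any intermediate length.\<close>

lemma sublist_extend:
  assumes "sublist x z" and "length x \<le> k" and "k \<le> length z"
  obtains y where "sublist x y" and "sublist y z" and "length y = k"
proof -
  from assms(1) obtain p s where z: "z = p @ x @ s" by (auto simp: sublist_def)
  \<comment> \<open>start at the factor itself, or earlier if too few letters follow\<close>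
  define d where "d = min (length p) (length z - k)"
  have "sublist x (take k (drop d z))"
  proof -
    have "take k (drop d z) = drop d p @ x @ take (k - (length p - d) - length x) s"
      using assms(2,3) by (auto simp: z d_def)
    then show ?thesis by (metis sublist_appendI)
  qed
  moreover have "length (take k (drop d z)) = k" using assms(3) by (auto simp: d_def)
  moreover have "sublist (take k (drop d z)) z"
    by (meson sublist_drop sublist_order.order_trans sublist_take)
  ultimately show thesis using that by blast
qed

lemma Av_sublist: "y \<in> Av A W \<Longrightarrow> sublist x y \<Longrightarrow> x \<in> Av A W"
  unfolding Av_def by (auto dest: set_mono_sublist sublist_order.order_trans)

text \<open>If \<open>x\<close> and \<open>y\<close> have no common extension, then the words without factor \<open>x\<close> and the words
  without factor \<open>y\<close> are two proper downward closed subsets that cover everything.\<close>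

lemma atomic_iff_joint_embedding:
  "atomic sublist (lists A) (Av A W) \<longleftrightarrow>
     (\<forall>x\<in>Av A W. \<forall>y\<in>Av A W. \<exists>z\<in>Av A W. sublist x z \<and> sublist y z)"
  (is "?atomic \<longleftrightarrow> ?joint")
proof
  assume ?atomic
  show ?joint
  proof (intro ballI, rule ccontr)
    fix x y assume xy: "x \<in> Av A W" "y \<in> Av A W"
      and none: "\<not> (\<exists>z\<in>Av A W. sublist x z \<and> sublist y z)"
    define below where "below u = {z \<in> Av A W. \<not> sublist u z}" for u
    have "downward_closed sublist (lists A) (below u)" for u
      unfolding downward_closed_def below_def
      by (auto simp: Av_def intro: sublist_order.order_trans dest: set_mono_sublist)
    moreover have "below x \<subset> Av A W" "below y \<subset> Av A W" using xy by (auto simp: below_def)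
    moreover have "Av A W = below x \<union> below y" using none by (auto simp: below_def)
    ultimately show False using \<open>?atomic\<close> unfolding atomic_def by blast
  qed
next
  assume joint: ?joint
  have "downward_closed sublist (lists A) (Av A W)"
    unfolding downward_closed_def using Av_sublist by (auto simp: Av_def)
  moreover have False
    if C: "downward_closed sublist (lists A) C1" "downward_closed sublist (lists A) C2"
      "C1 \<subset> Av A W" "C2 \<subset> Av A W" "Av A W = C1 \<union> C2" for C1 C2
  proof -
    obtain x y where xy: "x \<in> Av A W - C1" "y \<in> Av A W - C2" using C(3,4) by blast
    then obtain z where "z \<in> C1 \<union> C2" "sublist x z" "sublist y z" using joint C(5) by blast
    then show False using C(1,2) xy unfolding downward_closed_def Av_def by blast
  qed
  ultimately show ?atomic unfolding atomic_def by blast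
qed

text \<open>Lengths decrease along strict factors, so only antichains matter.\<close>

lemma well_quasi_ordered_iff:
  "well_quasi_ordered sublist X \<longleftrightarrow>
     \<not> (\<exists>Y \<subseteq> X. infinite Y \<and> (\<forall>x\<in>Y. \<forall>y\<in>Y. x \<noteq> y \<longrightarrow> \<not> sublist x y))"
proof -
  have False if s: "\<forall>i. s i \<in> X \<and> sublist (s (Suc i)) (s i) \<and> s (Suc i) \<noteq> s i" for s
  proof -
    have "(length (s (Suc i)), length (s i)) \<in> less_than" for i
    proof -
      obtain p t where "s i = p @ s (Suc i) @ t" using s unfolding sublist_def by blast
      moreover from this have "p \<noteq> [] \<or> t \<noteq> []" using s by (metis append_Nil append_Nil2)
      ultimately show ?thesis by auto
    qed
    then show False
      using wf_no_infinite_down_chainE[OF wf_less_than, of "\<lambda>i. length (s i)"] by blast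
  qed
  then show ?thesis unfolding well_quasi_ordered_def by blast
qed

locale avoidance =
  fixes A :: "'a set" and W :: "'a list set" and m :: nat
  assumes finite_A: "finite A" and m_pos: "0 < m"
    and length_W: "w \<in> W \<Longrightarrow> length w \<le> m"
begin

definition V :: "'a list set" where
  "V = {x \<in> Av A W. length x = m}"

definition E :: "'a list \<Rightarrow> 'a list \<Rightarrow> bool" where
  "E u v \<longleftrightarrow> u \<in> V \<and> v \<in> V \<and> tl u = butlast v"

sublocale finite_digraph V E
proof
  have "V \<subseteq> {x. set x \<subseteq> A \<and> length x = m}" by (auto simp: V_def Av_def)
  then show "finite V" using finite_lists_length_eq[OF finite_A] finite_subset by blast
  show "u \<in> V \<and> v \<in> V" if "E u v" for u v using that unfolding E_def by blast
qed

lemma walk_windows: "x \<in> Av A W \<Longrightarrow> walk (windows m x)"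
proof (induction x)
  case (Cons a x)
  have x: "x \<in> Av A W" using Av_sublist[OF Cons.prems sublist_tl] by simp
  have V: "take m y \<in> V" if "y \<in> Av A W" "m \<le> length y" for y
    using Av_sublist[OF that(1) sublist_take] that(2) by (simp add: V_def)
  have "E (take m (a # x)) (hd (windows m x))" if "m \<le> length x"
    using that V[OF Cons.prems] V[OF x] m_pos hd_windows[OF m_pos that]
    by (auto simp: E_def butlast_take take_Cons' )
  then show ?case
    using Cons.IH[OF x] V[OF Cons.prems] windows_eq_Nil_iff[OF m_pos, of x]
    by (auto simp: walk_Cons)
qed simp

text \<open>Prepending the first letter of the first vertex to the word of the remaining walk can create a
  forbidden factor only as a prefix; such a prefix has length at most \<open>m\<close> and so lies in the first
  vertex, which avoids it.\<close>

lemma word_of_walk: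
  "walk p \<Longrightarrow> p \<noteq> [] \<Longrightarrow> \<exists>x. x \<in> Av A W \<and> m \<le> length x \<and> windows m x = p"
proof (induction p)
  case (Cons u p)
  have "u \<in> V" using Cons.prems by (simp add: walk_Cons)
  then have u: "u \<in> Av A W" "length u = m" by (simp_all add: V_def)
  then obtain a u' where u': "u = a # u'" using m_pos by (cases u) auto
  show ?case
  proof (cases "p = []")
    case True
    have "windows m u = [u]" using u u' windows_eq_Nil_iff[OF m_pos, of u'] by simp
    then show ?thesis using u True by auto
  next
    case False
    then obtain x where x: "x \<in> Av A W" "m \<le> length x" "windows m x = p"
      using Cons by (auto simp: walk_Cons)
    have "E u (take m x)" using Cons.prems False x hd_windows[OF m_pos x(2)] by (auto simp: walk_Cons)
    then have "u' = take (m - 1) x"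
      using x(2) by (simp add: E_def u' butlast_take)
    then have take: "take m (a # x) = u" using u' m_pos by (simp add: take_Cons')
    have "a # x \<in> Av A W"
    proof -
      have False if "w \<in> W" "prefix w (a # x)" for w
      proof -
        have "prefix w (take m (a # x))"
          using that length_W[OF that(1)] by (auto simp: prefix_def)
        then have "sublist w u" using take by auto
        then show False using u(1) that(1) by (auto simp: Av_def)
      qed
      then show ?thesis using u(1) x(1) u' by (auto simp: Av_def sublist_Cons_right)
    qed
    then show ?thesis using x take by (intro exI[of _ "a # x"]) auto
  qed
qed simp

lemma joint_walk_iff:
  assumes "x \<in> Av A W" "m \<le> length x" and "y \<in> Av A W" "m \<le> length y"
  shows "(\<exists>z\<in>Av A W. sublist x z \<and> sublist y z \<and> length z \<le> k + m) \<longleftrightarrow>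
    (\<exists>p. walk p \<and> sublist (windows m x) p \<and> sublist (windows m y) p \<and> length p \<le> Suc k)"
proof
  assume "\<exists>z\<in>Av A W. sublist x z \<and> sublist y z \<and> length z \<le> k + m"
  then obtain z where "z \<in> Av A W" "sublist x z" "sublist y z" "length z \<le> k + m" by blast
  then show "\<exists>p. walk p \<and> sublist (windows m x) p \<and> sublist (windows m y) p \<and> length p \<le> Suc k"
    using walk_windows assms sublist_windows_iff[OF m_pos]
    by (intro exI[of _ "windows m z"]) (auto simp: length_windows[OF m_pos])
next
  assume "\<exists>p. walk p \<and> sublist (windows m x) p \<and> sublist (windows m y) p \<and> length p \<le> Suc k"
  then obtain p where p: "walk p" "sublist (windows m x) p" "sublist (windows m y) p" "length p \<le> Suc k"
    by blast
  have "p \<noteq> []" using p(2) assms(2) windows_eq_Nil_iff[OF m_pos, of x] by auto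
  then obtain z where z: "z \<in> Av A W" "m \<le> length z" "windows m z = p" using word_of_walk p(1) by blast
  then have "length z \<le> k + m" using p(4) length_windows[OF m_pos, of z] by simp
  then show "\<exists>z\<in>Av A W. sublist x z \<and> sublist y z \<and> length z \<le> k + m"
    using z p assms sublist_windows_iff[OF m_pos] by blast
qed

text \<open>Short words are first widened to length \<open>m\<close> inside the common extension, to make them walks.\<close>

lemma joint_word_shorten:
  assumes x: "x \<in> Av A W" and y: "y \<in> Av A W"
    and z: "z \<in> Av A W" "sublist x z" "sublist y z"
  shows "\<exists>z\<in>Av A W. sublist x z \<and> sublist y z \<and>
    length z \<le> length x + length y + m + m + card V"
proof (cases "m \<le> length z")
  case True
  have ext: "\<exists>u. sublist x u \<and> sublist u z \<and> m \<le> length u \<and> length u \<le> length x + m"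
    if "sublist x z" for x
  proof (cases "m \<le> length x")
    case False
    then show ?thesis using sublist_extend[OF that _ True] by (metis le_add2 nat_le_linear order_refl)
  qed (use that in auto)
  obtain u where u: "sublist x u" "sublist u z" "m \<le> length u" "length u \<le> length x + m"
    using ext[OF z(2)] by blast
  obtain v where v: "sublist y v" "sublist v z" "m \<le> length v" "length v \<le> length y + m"
    using ext[OF z(3)] by blast
  have uv: "u \<in> Av A W" "v \<in> Av A W" using Av_sublist z(1) u v by blast+
  have "sublist (windows m u) (windows m z)" "sublist (windows m v) (windows m z)"
    using u v sublist_windows_iff[OF m_pos] by auto
  from joint_walk_shorten[OF walk_windows[OF z(1)] this]
  obtain p where "walk p \<and> sublist (windows m u) p \<and> sublist (windows m v) p \<and>
      length p \<le> Suc (length u - m) + Suc (length v - m) + card V"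
    using u(3) v(3) by (auto simp: length_windows[OF m_pos] Suc_diff_le)
  then obtain z' where "z' \<in> Av A W" "sublist u z'" "sublist v z'"
      "length z' \<le> (Suc (length u - m) + (length v - m) + card V) + m"
    using joint_walk_iff[OF uv(1) u(3) uv(2) v(3),
        of "Suc (length u - m) + (length v - m) + card V"] by auto
  then show ?thesis using u v m_pos
    by (intro bexI[of _ z'] conjI) (auto intro: sublist_order.order_trans)
qed (use z in auto)

text \<open>For a short word \<open>u\<close> and a very long word \<open>v\<close>, a common extension of \<open>u\<close> and a long prefix of \<open>v\<close>
  shows that \<open>u\<close> has an avoiding extension \<open>u'\<close> of length \<open>m\<close>, and the long words \<open>u'\<close> and \<open>v\<close> can be
  joined.\<close>

lemma joint_embedding_bounded_words:
  assumes B: "m + card V + 3 \<le> B"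
    and short: "\<And>x y. x \<in> Av A W \<Longrightarrow> y \<in> Av A W \<Longrightarrow> length x \<le> B \<Longrightarrow> length y \<le> B \<Longrightarrow>
      \<exists>z\<in>Av A W. sublist x z \<and> sublist y z"
    and x: "x \<in> Av A W" and y: "y \<in> Av A W"
  shows "\<exists>z\<in>Av A W. sublist x z \<and> sublist y z"
proof -
  have walks: "\<exists>r. walk r \<and> sublist p r \<and> sublist q r"
    if pq: "walk p" "walk q" "length p \<le> card V + 4" "length q \<le> card V + 4" for p q
  proof (cases "p = [] \<or> q = []")
    case True
    then show ?thesis using pq by (intro exI[of _ "p @ q"]) auto
  next
    case False
    then obtain u v where u: "u \<in> Av A W" "m \<le> length u" "windows m u = p"
      and v: "v \<in> Av A W" "m \<le> length v" "windows m v = q"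
      using word_of_walk pq by metis
    have "length u \<le> B" "length v \<le> B"
      using length_windows[OF m_pos, of u] length_windows[OF m_pos, of v] u v pq B by auto
    then obtain z where "z \<in> Av A W" "sublist u z" "sublist v z" using short u v by blast
    then show ?thesis
      using walk_windows sublist_windows_iff[OF m_pos] u v by blast
  qed
  have long: "\<exists>z\<in>Av A W. sublist u z \<and> sublist v z"
    if u: "u \<in> Av A W" "m \<le> length u" and v: "v \<in> Av A W" "m \<le> length v" for u v
  proof -
    obtain p where "walk p" "sublist (windows m u) p" "sublist (windows m v) p"
      using joint_embedding_bounded[OF walks walk_windows[OF u(1)] walk_windows[OF v(1)]] by blast
    then show ?thesis using joint_walk_iff[OF u v, of "length p"] by (meson le_SucI order_refl)
  qed
  have mixed: "\<exists>z\<in>Av A W. sublist u z \<and> sublist v z"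
    if u: "u \<in> Av A W" "length u < m" and v: "v \<in> Av A W" for u v
  proof (cases "length v \<le> B")
    case True
    then show ?thesis using short u v B by simp
  next
    case False
    have "take B v \<in> Av A W" using v Av_sublist by blast
    then obtain z where z: "z \<in> Av A W" "sublist u z" "sublist (take B v) z"
      using short[of u "take B v"] u v B by auto
    have "m \<le> length z" using sublist_length_le[OF z(3)] False B by simp
    then obtain u' where u': "sublist u u'" "sublist u' z" "length u' = m"
      using sublist_extend[OF z(2)] u(2) by (metis less_imp_le)
    have "u' \<in> Av A W" using u' z(1) Av_sublist by blast
    then obtain z' where "z' \<in> Av A W" "sublist u' z'" "sublist v z'"
      using long[of u' v] u'(3) v False B by auto
    then show ?thesis using u'(1) sublist_order.order_trans by blast
  qed
  show ?thesis
    using long[OF x _ y] mixed[OF x _ y] mixed[OF y _ x] by (meson not_le)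
qed

text \<open>The last bound is twice the bound on \<open>x\<close> and \<open>y\<close>, plus the amount \<open>2 * m + N\<close> of
  \<open>joint_word_shorten\<close>.\<close>

lemma atomic_iff_bounded:
  assumes N: "card V \<le> N"
  shows "atomic sublist (lists A) (Av A W) \<longleftrightarrow>
    (\<forall>x y. x \<in> Av A W \<and> y \<in> Av A W \<and> length x \<le> m + N + 3 \<and> length y \<le> m + N + 3 \<longrightarrow>
      (\<exists>z\<in>Av A W. sublist x z \<and> sublist y z \<and> length z \<le> 4 * m + 3 * N + 6))"
  (is "_ \<longleftrightarrow> ?bounded")
proof -
  have "?bounded" if joint: "\<forall>x\<in>Av A W. \<forall>y\<in>Av A W. \<exists>z\<in>Av A W. sublist x z \<and> sublist y z"
  proof (intro allI impI)
    fix x y assume xy: "x \<in> Av A W \<and> y \<in> Av A W \<and> length x \<le> m + N + 3 \<and> length y \<le> m + N + 3"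
    then obtain z0 where "z0 \<in> Av A W" "sublist x z0" "sublist y z0" using joint by blast
    then obtain z where "z \<in> Av A W" "sublist x z" "sublist y z"
        "length z \<le> length x + length y + m + m + card V"
      using joint_word_shorten[of x y z0] xy by blast
    then show "\<exists>z\<in>Av A W. sublist x z \<and> sublist y z \<and> length z \<le> 4 * m + 3 * N + 6"
      using xy N by (intro bexI[of _ z]) auto
  qed
  moreover have "\<forall>x\<in>Av A W. \<forall>y\<in>Av A W. \<exists>z\<in>Av A W. sublist x z \<and> sublist y z" if bounded: ?bounded
  proof (intro ballI)
    fix x y assume "x \<in> Av A W" "y \<in> Av A W"
    then show "\<exists>z\<in>Av A W. sublist x z \<and> sublist y z"
    proof (rule joint_embedding_bounded_words[rotated 2])
      show "m + card V + 3 \<le> m + N + 3" using N by simp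
    qed (use bounded in blast)
  qed
  ultimately show ?thesis unfolding atomic_iff_joint_embedding by blast
qed

lemma well_quasi_ordered_iff_no_in_out_cycle:
  "well_quasi_ordered sublist (Av A W) \<longleftrightarrow> \<not> in_out_cycle"
proof -
  have "finite X" if no: "\<not> in_out_cycle" and X: "X \<subseteq> Av A W"
    and anti: "\<forall>x\<in>X. \<forall>y\<in>X. x \<noteq> y \<longrightarrow> \<not> sublist x y" for X
  proof -
    let ?long = "{x\<in>X. m \<le> length x}"
    have "finite (windows m ` ?long)"
    proof (rule walk_antichain_finite[OF no])
      show "walk p" if "p \<in> windows m ` ?long" for p
        using that X walk_windows by auto
      show "p = q" if "p \<in> windows m ` ?long" "q \<in> windows m ` ?long" "sublist p q" for p q
      proof -
        from that(1,2) obtain x y where "x \<in> ?long" "p = windows m x" "y \<in> ?long" "q = windows m y"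
          by blast
        then show ?thesis using that(3) anti sublist_windows_iff[OF m_pos, of x y] by auto
      qed
    qed
    moreover have "inj_on (windows m) ?long"
      using inj_on_windows[OF m_pos] by (rule inj_on_subset) auto
    ultimately have "finite ?long" by (rule finite_imageD)
    moreover have "finite {x\<in>X. length x < m}"
    proof (rule finite_subset[OF _ finite_lists_length_le[OF finite_A, of m]])
      show "{x\<in>X. length x < m} \<subseteq> {xs. set xs \<subseteq> A \<and> length xs \<le> m}"
        using X by (auto simp: Av_def)
    qed
    moreover have "X = ?long \<union> {x\<in>X. length x < m}" by auto
    ultimately show ?thesis by (metis finite_Un)
  qed
  moreover have "\<exists>X\<subseteq>Av A W. infinite X \<and> (\<forall>x\<in>X. \<forall>y\<in>X. x \<noteq> y \<longrightarrow> \<not> sublist x y)" if cycle: in_out_cycle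
  proof -
    obtain P where P: "infinite P" "\<And>p. p \<in> P \<Longrightarrow> walk p \<and> p \<noteq> []"
      "\<And>p q. p \<in> P \<Longrightarrow> q \<in> P \<Longrightarrow> p \<noteq> q \<Longrightarrow> \<not> sublist p q"
      using walk_antichain_infinite[OF cycle] by blast
    have "\<forall>p\<in>P. \<exists>x. x \<in> Av A W \<and> m \<le> length x \<and> windows m x = p"
      using word_of_walk P(2) by blast
    then obtain f where f: "\<And>p. p \<in> P \<Longrightarrow> f p \<in> Av A W \<and> m \<le> length (f p) \<and> windows m (f p) = p"
      by metis
    have "inj_on f P" by (rule inj_onI) (metis f)
    then have "infinite (f ` P)" using P(1) by (simp add: finite_image_iff)
    moreover have "\<not> sublist (f p) (f q)" if "p \<in> P" "q \<in> P" "p \<noteq> q" for p q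
      using sublist_windows_iff[OF m_pos, of "f p" "f q"] f that P(3) by auto
    ultimately show ?thesis using f by (intro exI[of _ "f ` P"]) auto
  qed
  ultimately show ?thesis unfolding well_quasi_ordered_iff by blast
qed

lemma tranclp_iff_word:
  assumes N: "card V \<le> N"
  shows "E\<^sup>+\<^sup>+ u v \<longleftrightarrow>
    (\<exists>k\<le>N. \<exists>z\<in>Av A W. length z = m + Suc k \<and> take m z = u \<and> drop (Suc k) z = v)"
proof
  assume "E\<^sup>+\<^sup>+ u v"
  then obtain g where g: "walk (u # g @ [v])" "length g \<le> card V" by (auto simp: tranclp_iff_walk)
  then obtain z where z: "z \<in> Av A W" "m \<le> length z" "windows m z = u # g @ [v]"
    using word_of_walk by blast
  have len: "length z = m + Suc (length g)" using length_windows[OF m_pos, of z] z by simp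
  moreover have "take m z = u" "drop (Suc (length g)) z = v"
    using hd_windows[OF m_pos z(2)] last_windows[OF m_pos z(2)] z(3) len by auto
  ultimately show "\<exists>k\<le>N. \<exists>z\<in>Av A W. length z = m + Suc k \<and> take m z = u \<and> drop (Suc k) z = v"
    using z(1) g(2) N by (intro exI[of _ "length g"]) auto
next
  assume "\<exists>k\<le>N. \<exists>z\<in>Av A W. length z = m + Suc k \<and> take m z = u \<and> drop (Suc k) z = v"
  then obtain k z where z: "z \<in> Av A W" "length z = m + Suc k" "take m z = u" "drop (Suc k) z = v"
    by blast
  have len: "length (windows m z) = Suc (Suc k)" by (simp add: length_windows[OF m_pos] z(2))
  have "hd (windows m z) = u" "last (windows m z) = v"
    using hd_windows[OF m_pos, of z] last_windows[OF m_pos, of z] z by auto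
  then obtain g where "windows m z = [] @ u # g @ v # []"
    using len by (cases "windows m z"; cases "tl (windows m z)" rule: rev_cases) auto
  then show "E\<^sup>+\<^sup>+ u v" using walk_reach_between walk_windows[OF z(1)] by metis
qed

end

section \<open>The decision procedures\<close>

text \<open>The programs compute with an instance \<open>i\<close>, a pair of the list of letters and the list of forbidden
  words.\<close>

definition avoiding :: "nat list \<times> nat list list \<Rightarrow> nat \<Rightarrow> nat list list" where
  "avoiding i k = filter (\<lambda>x. \<forall>w\<in>set (snd i). \<not> sublist w x) (List.n_lists k (fst i))"

text \<open>The total length of the forbidden words bounds each of them; the successor makes it positive.\<close>

definition window_length :: "nat list \<times> nat list list \<Rightarrow> nat" where
  "window_length i = Suc (length (concat (snd i)))"

abbreviation window_list :: "nat list \<times> nat list list \<Rightarrow> nat list list" where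
  "window_list i \<equiv> avoiding i (window_length i)"

definition avoiding_upto :: "nat list \<times> nat list list \<Rightarrow> nat \<Rightarrow> nat list list" where
  "avoiding_upto i b = concat (map (\<lambda>k. avoiding i k) [0..<Suc b])"

text \<open>The length of \<open>window_list i\<close> bounds the number of vertices of the digraph. Products are written as
  sums because addition is the operation available to the programs.\<close>

definition atomic_check :: "nat list \<times> nat list list \<Rightarrow> bool" where
  "atomic_check i \<longleftrightarrow>
    (\<forall>x\<in>set (avoiding_upto i (window_length i + length (window_list i) + 3)).
     \<forall>y\<in>set (avoiding_upto i (window_length i + length (window_list i) + 3)).
     \<exists>z\<in>set (avoiding_upto i (window_length i + window_length i + window_length i +
        window_length i + length (window_list i) + length (window_list i) +
        length (window_list i) + 6)).
       sublist x z \<and> sublist y z)"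

text \<open>Reachability by at least one edge: a walk with \<open>k + 2\<close> vertices is a word of length \<open>m + k + 1\<close> that
  begins with its first and ends with its last vertex.\<close>

definition reach_check :: "nat list \<times> nat list list \<Rightarrow> nat list \<Rightarrow> nat list \<Rightarrow> bool" where
  "reach_check i u v \<longleftrightarrow>
    (\<exists>k\<in>set [0..<Suc (length (window_list i))]. \<exists>z\<in>set (avoiding i (window_length i + Suc k)).
      take (window_length i) z = u \<and> drop (Suc k) z = v)"

definition in_out_cycle_check :: "nat list \<times> nat list list \<Rightarrow> bool" where
  "in_out_cycle_check i \<longleftrightarrow> (\<exists>v\<in>set (window_list i). reach_check i v v \<and>
    (\<exists>x\<in>set (window_list i). reach_check i v x \<and> (\<exists>x1\<in>set (window_list i).
      \<exists>x2\<in>set (window_list i). tl x = butlast x1 \<and> tl x = butlast x2 \<and> x1 \<noteq> x2)) \<and>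
    (\<exists>y\<in>set (window_list i). reach_check i y v \<and> (\<exists>y1\<in>set (window_list i).
      \<exists>y2\<in>set (window_list i). tl y1 = butlast y \<and> tl y2 = butlast y \<and> y1 \<noteq> y2)))"

lemma computable_avoiding [computable_intros]:
  assumes "computable f" and "computable g" shows "computable (\<lambda>x. avoiding (f x) (g x))"
  unfolding avoiding_def by (intro computable_intros assms computable_comp[OF assms(1)])

lemma computable_avoiding_upto [computable_intros]:
  assumes "computable f" and "computable g" shows "computable (\<lambda>x. avoiding_upto (f x) (g x))"
  unfolding avoiding_upto_def by (intro computable_intros assms computable_comp[OF assms(1)])

lemma computable_window_length [computable_intros]:
  assumes "computable f" shows "computable (\<lambda>x. window_length (f x))"
  unfolding window_length_def by (intro computable_intros assms)

lemma computable_atomic_check: "computable atomic_check"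
  unfolding atomic_check_def by (intro computable_intros)

lemma computable_reach_check: "computable (\<lambda>p. reach_check (fst p) (fst (snd p)) (snd (snd p)))"
  unfolding reach_check_def by (intro computable_intros)

lemma computable_reach_check_comp [computable_intros]:
  assumes "computable f" and "computable g" and "computable h"
  shows "computable (\<lambda>x. reach_check (f x) (g x) (h x))"
  using computable_comp[OF computable_reach_check computable_Pair[OF assms(1) computable_Pair[OF assms(2,3)]]]
  by simp

lemma computable_in_out_cycle_check: "computable in_out_cycle_check"
  unfolding in_out_cycle_check_def by (intro computable_intros)

lemma set_avoiding: "set (avoiding (as, ws) k) = {x \<in> Av (set as) (set ws). length x = k}"
  by (auto simp: avoiding_def set_n_lists Av_def)

lemma set_avoiding_upto:
  "set (avoiding_upto (as, ws) b) = {x \<in> Av (set as) (set ws). length x \<le> b}"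
  by (auto simp: avoiding_upto_def set_avoiding less_Suc_eq_le simp del: upt_Suc)

lemma avoidance_window_length: "avoidance (set as) (set ws) (window_length (as, ws))"
proof
  show "length w \<le> window_length (as, ws)" if "w \<in> set ws" for w
    using member_le_sum_list[of "length w" "map length ws"] that
    by (simp add: window_length_def length_concat)
qed (simp_all add: window_length_def)

lemma atomic_check_correct:
  "atomic_check (as, ws) \<longleftrightarrow> atomic sublist (lists (set as)) (Av (set as) (set ws))"
proof -
  interpret avoidance "set as" "set ws" "window_length (as, ws)" by (rule avoidance_window_length)
  have V: "V = set (window_list (as, ws))" by (auto simp: V_def set_avoiding)
  have N: "card V \<le> length (window_list (as, ws))" unfolding V by (rule card_length)
  have "m + m + m + m + n + n + n + 6 = 4 * m + 3 * n + 6" for m n :: nat by simp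
  then show ?thesis unfolding atomic_iff_bounded[OF N] atomic_check_def set_avoiding_upto
    by (simp only:) blast
qed

text \<open>The program omits the membership tests of the edge relation, since all vertices involved
  range over the list of vertices.\<close>

lemma in_out_cycle_check_correct:
  "in_out_cycle_check (as, ws) \<longleftrightarrow> \<not> well_quasi_ordered sublist (Av (set as) (set ws))"
proof -
  interpret avoidance "set as" "set ws" "window_length (as, ws)" by (rule avoidance_window_length)
  have V: "V = set (window_list (as, ws))" by (auto simp: V_def set_avoiding)
  have N: "card V \<le> length (window_list (as, ws))" unfolding V by (rule card_length)
  have reach: "reach_check (as, ws) u v \<longleftrightarrow> E\<^sup>+\<^sup>+ u v" for u v
    unfolding tranclp_iff_word[OF N] reach_check_def
    by (auto simp: set_avoiding less_Suc_eq_le simp del: upt_Suc)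
  have in_V: "u \<in> V \<and> v \<in> V" if "E\<^sup>+\<^sup>+ u v" for u v
    using that unfolding tranclp_iff_walk walk_def by auto
  have "in_out_cycle_check (as, ws) \<longleftrightarrow> in_out_cycle"
    unfolding in_out_cycle_check_def in_out_cycle_def out_branching_def in_branching_def
      reach V[symmetric]
    using in_V by (simp only: E_def) blast
  then show ?thesis by (simp add: well_quasi_ordered_iff_no_in_out_cycle)
qed

theorem theorem1p1:
  "decidable (decision_problem (\<lambda>A W. atomic sublist (lists A) (Av A W))) \<and>
   decidable (decision_problem (\<lambda>A W. well_quasi_ordered sublist (Av A W)))"
proof
  show "decidable (decision_problem (\<lambda>A W. atomic sublist (lists A) (Av A W)))"
    by (rule decidable_decision_problem[OF computable_atomic_check atomic_check_correct])
  have "computable (\<lambda>i. \<not> in_out_cycle_check i)"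
    by (rule computable_not[OF computable_in_out_cycle_check])
  then show "decidable (decision_problem (\<lambda>A W. well_quasi_ordered sublist (Av A W)))"
    by (rule decidable_decision_problem) (simp add: in_out_cycle_check_correct)
qed

end
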